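(* Assume that $r_n=\sup_{x\in\mathbb R}|\mathbb K_n(x)-\mathbb K(x)|\to 0$ as $n\to\infty$ and that $\mathbb K$ has a density $\mathbb K'$ with $\|\mathbb K'\|_\infty<\infty$. Let $\delta>0$ and let $p\ge 1$ be an integer. Assume that one of the following four sets of conditions holds (as $n\to\infty$). (i) The overlapping scheme is used, $X$ is $\eta$-weakly dependent, $\sum_{t=0}^{\infty}(t+1)^{p-2}\eta(t)<\infty$ and $\frac bn\left(1\vee\frac{L(b)}{\epsilon_n}\right)\prec n^{-\delta}$. (ii) The overlapping scheme is used, $X$ is $\lambda$-weakly dependent, $\sum_{t=0}^{\infty}(t+1)^{p-2}\lambda(t)<\infty$ and $\frac bn\left(1\vee\frac{L(b)}{\epsilon_n}\vee\frac{bL(b)^2}{\epsilon_n^2}\right)\prec n^{-\delta}$. (iii) The non-overlapping scheme is used, $X$ is $\eta$-weakly dependent, $\sum_{t=0}^{n-1}(t+1)^{p-2}\eta(t)\prec b^{p-2}$ and $\frac bn\left(1\vee\frac{bL(b)}{\epsilon_n}\right)\prec n^{-\delta}$. (iv) The non-overlapping scheme is used, $X$ is $\lambda$-weakly dependent, $\sum_{t=0}^{n-1}(t+1)^{p-2}\lambda(t)\prec b^{p-2}$ and $\frac bn\left(1\vee\frac{bL(b)}{\epsilon_n}\vee\frac{bL(b)^2}{\epsilon_n^2}\right)\prec n^{-\delta}$. Then, for every $x\in\mathbb R$, $\widetilde\Delta^{(p)}_{b,n}(x)\prec n^{-[p/2]\delta}$. Hence, if $p/2$ is an integer and $p\delta>2$,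 then $$\sup_{x\in\mathbb R}\left|\widetilde{\mathbb K}_{b,n}(x)-\mathbb K(x)\right|\to_{n\to\infty}0\quad\text{almost surely}.$$
   Context: Notation: for sequences, $a\prec b$ means there is a constant $c>0$ with $a_n\le c\,b_n$ for all $n$; $[\cdot]$ is the integer part; $\vee$ is the maximum. For $h:E^u\to\mathbb R$ ($E$ a normed space), $\mathrm{Lip}\,h=\sup_{x\ne y}\frac{|h(y_1,\dots,y_u)-h(x_1,\dots,x_u)|}{\|y_1-x_1\|+\cdots+\|y_u-x_u\|}$. Weak dependence: $X=(X_t)_{t\in\mathbb Z}$ is a strictly stationary real-valued sequence. For a functional $\Psi$, put $$\varepsilon(r)=\sup\frac{|\mathrm{Cov}(f(X_{s_1},\dots,X_{s_u}),g(X_{t_1},\dots,X_{t_v}))|}{\Psi(f,g)},$$ the supremum being over $u,v\ge1$, $s_1\le\dots\le s_u\le t_1\le\dots\le t_v$ with $r=t_1-s_u$, and $f:\mathbb R^u\to\mathbb R$, $g:\mathbb R^v\to\mathbb R$ with $\mathrm{Lip}\,f,\mathrm{Lip}\,g<\infty$, $\|f\|_\infty\le1$, $\|g\|_\infty\le1$ (with $0/0=0$). With $\Psi(f,g)=u\,\mathrm{Lip}f+v\,\mathrm{Lip}g$ write $\varepsilon(r)=\eta(r)$; with $\Psi(f,g)=u\,\mathrm{Lip}f+v\,\mathrm{Lip}g+uv\,\mathrm{Lip}f\cdot\mathrm{Lip}g$ write $\varepsilon(r)=\lambda(r)$. $X$ is $\eta$-weakly (resp. $\lambda$-weakly) dependent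 if $\eta(r)\to0$ (resp. $\lambda(r)\to0$) as $r\to\infty$. Subsampling: $S_n=s_n(X_1,\dots,X_n)$, $n\ge1$, is a sequence of real statistics ($s_n:\mathbb R^n\to\mathbb R$), $\mathbb K_n(x)=\mathbb P(S_n\le x)$, and $\mathbb K$ is the limit distribution function of $\mathbb K_n$. $L(b)=\mathrm{Lip}\,s_b$. $b=b_n$ is a sequence of positive integers with $b_n\to\infty$ and $n/b_n\to\infty$. $\epsilon_n\downarrow0$ is a sequence of positive numbers. Overlapping scheme: $Y_{b,i}=(X_{i+1},\dots,X_{i+b})$, $N=n-b$. Non-overlapping scheme: $Y_{b,i}=(X_{(i-1)b+1},\dots,X_{ib})$, $N=n/b$ (understood to be an integer). $\varphi:\mathbb R\to[0,1]$ is continuous, $\varphi(x)=1$ for $x\le0$, $\varphi(x)=0$ for $x\ge1$, and affine on $[0,1]$. The smooth subsampling estimator is $\widetilde{\mathbb K}_{b,n}(x)=\frac1N\sum_{i=0}^{N-1}\varphi\left(\frac{s_b(Y_{b,i})-x}{\epsilon_n}\right)$, and $\widetilde\Delta^{(p)}_{b,n}(x)=\left|\mathbb E\left[\left(\widetilde{\mathbb K}_{b,n}(x)-\mathbb E\widetilde{\mathbb K}_{b,n}(x)\right)^p\right]\right|$. *)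

theory Defs
  imports "HOL-Probability.Probability"
begin

(* A function of u variables is h :: (nat => 'a) => real, of which only the values on
   PiE {..<u} (%_. UNIV) matter; this set is the space of PiM {..<u} (%_. borel). *)

definition Lip :: "nat \<Rightarrow> ((nat \<Rightarrow> 'a::real_normed_vector) \<Rightarrow> real) \<Rightarrow> ennreal" where
  "Lip u h = (SUP (x, y) \<in> {(x, y). x \<in> {..<u} \<rightarrow>\<^sub>E UNIV \<and> y \<in> {..<u} \<rightarrow>\<^sub>E UNIV \<and> x \<noteq> y}.
     ennreal (\<bar>h y - h x\<bar> / (\<Sum>i<u. norm (y i - x i))))"

definition asymp_le :: "(nat \<Rightarrow> ennreal) \<Rightarrow> (nat \<Rightarrow> ennreal) \<Rightarrow> bool" (infix "\<prec>" 50) where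
  "a \<prec> d \<longleftrightarrow> (\<exists>c>0. \<forall>n\<ge>1. a n \<le> ennreal c * d n)"

definition strictly_stationary :: "'w measure \<Rightarrow> (int \<Rightarrow> 'w \<Rightarrow> real) \<Rightarrow> bool" where
  "strictly_stationary M X \<longleftrightarrow> (\<forall>J h. finite J \<longrightarrow>
     distr M (Pi\<^sub>M J (\<lambda>_. borel)) (\<lambda>\<omega>. \<lambda>j\<in>J. X (j + h) \<omega>) =
     distr M (Pi\<^sub>M J (\<lambda>_. borel)) (\<lambda>\<omega>. \<lambda>j\<in>J. X j \<omega>))"

definition tuple :: "(int \<Rightarrow> 'w \<Rightarrow> real) \<Rightarrow> nat \<Rightarrow> (nat \<Rightarrow> int) \<Rightarrow> 'w \<Rightarrow> nat \<Rightarrow> real" where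
  "tuple X u s \<omega> = (\<lambda>i\<in>{..<u}. X (s i) \<omega>)"

definition Cov :: "'w measure \<Rightarrow> ('w \<Rightarrow> real) \<Rightarrow> ('w \<Rightarrow> real) \<Rightarrow> real" where
  "Cov M U V = (\<integral>\<omega>. (U \<omega> - (\<integral>\<omega>. U \<omega> \<partial>M)) * (V \<omega> - (\<integral>\<omega>. V \<omega> \<partial>M)) \<partial>M)"

definition test_fun :: "nat \<Rightarrow> ((nat \<Rightarrow> real) \<Rightarrow> real) \<Rightarrow> bool" where
  "test_fun u f \<longleftrightarrow> Lip u f < \<infinity> \<and> (\<forall>x \<in> {..<u} \<rightarrow>\<^sub>E UNIV. \<bar>f x\<bar> \<le> 1)"

(* The supremum may be infinite for heavy-tailed X, hence the extended values;
   0 / 0 = 0 holds in ennreal. *)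

definition dep_coeff ::
  "(nat \<Rightarrow> ((nat \<Rightarrow> real) \<Rightarrow> real) \<Rightarrow> nat \<Rightarrow> ((nat \<Rightarrow> real) \<Rightarrow> real) \<Rightarrow> ennreal) \<Rightarrow>
   'w measure \<Rightarrow> (int \<Rightarrow> 'w \<Rightarrow> real) \<Rightarrow> nat \<Rightarrow> ennreal" where
  "dep_coeff \<Psi> M X r = Sup
     {ennreal \<bar>Cov M (\<lambda>\<omega>. f (tuple X u s \<omega>)) (\<lambda>\<omega>. g (tuple X v t \<omega>))\<bar> / \<Psi> u f v g | u v s t f g.
        u \<ge> 1 \<and> v \<ge> 1 \<and> mono_on {..<u} s \<and> mono_on {..<v} t \<and>
        t 0 - s (u - 1) = int r \<and> test_fun u f \<and> test_fun v g}"

definition eta_coeff :: "'w measure \<Rightarrow> (int \<Rightarrow> 'w \<Rightarrow> real) \<Rightarrow> nat \<Rightarrow> ennreal" where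
  "eta_coeff = dep_coeff (\<lambda>u f v g. of_nat u * Lip u f + of_nat v * Lip v g)"

definition lambda_coeff :: "'w measure \<Rightarrow> (int \<Rightarrow> 'w \<Rightarrow> real) \<Rightarrow> nat \<Rightarrow> ennreal" where
  "lambda_coeff = dep_coeff (\<lambda>u f v g. of_nat u * Lip u f + of_nat v * Lip v g
     + of_nat u * of_nat v * Lip u f * Lip v g)"

definition eta_weakly_dependent :: "'w measure \<Rightarrow> (int \<Rightarrow> 'w \<Rightarrow> real) \<Rightarrow> bool" where
  "eta_weakly_dependent M X \<longleftrightarrow> eta_coeff M X \<longlonglongrightarrow> 0"

definition lambda_weakly_dependent :: "'w measure \<Rightarrow> (int \<Rightarrow> 'w \<Rightarrow> real) \<Rightarrow> bool" where
  "lambda_weakly_dependent M X \<longleftrightarrow> lambda_coeff M X \<longlonglongrightarrow> 0"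

definition stat_cdf ::
  "'w measure \<Rightarrow> (int \<Rightarrow> 'w \<Rightarrow> real) \<Rightarrow> (nat \<Rightarrow> (nat \<Rightarrow> real) \<Rightarrow> real) \<Rightarrow> nat \<Rightarrow> real \<Rightarrow> real" where
  "stat_cdf M X s n x =
     measure M {\<omega> \<in> space M. s n (tuple X n (\<lambda>j. int j + 1) \<omega>) \<le> x}"

datatype scheme = Overlapping | Nonoverlapping

fun block :: "scheme \<Rightarrow> (int \<Rightarrow> 'w \<Rightarrow> real) \<Rightarrow> nat \<Rightarrow> nat \<Rightarrow> 'w \<Rightarrow> nat \<Rightarrow> real" where
  "block Overlapping X b i = tuple X b (\<lambda>j. int i + int j + 1)"
| "block Nonoverlapping X b i = tuple X b (\<lambda>j. (int i - 1) * int b + int j + 1)"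

(* In the non-overlapping scheme the number of blocks is the integer part of n / b:
   requiring b to divide n for every n would contradict b --> oo and n / b --> oo
   (take n prime). *)

fun num_blocks :: "scheme \<Rightarrow> nat \<Rightarrow> nat \<Rightarrow> nat" where
  "num_blocks Overlapping b n = n - b"
| "num_blocks Nonoverlapping b n = n div b"

definition phi :: "real \<Rightarrow> real" where
  "phi x = (if x \<le> 0 then 1 else if x \<ge> 1 then 0 else 1 - x)"

(* e is the smoothing parameter; the value is 0 if there are no blocks. *)

definition smooth_subsampling ::
  "scheme \<Rightarrow> (int \<Rightarrow> 'w \<Rightarrow> real) \<Rightarrow> (nat \<Rightarrow> (nat \<Rightarrow> real) \<Rightarrow> real) \<Rightarrow> nat \<Rightarrow> real \<Rightarrow> nat \<Rightarrow> real \<Rightarrow> 'w \<Rightarrow> real"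
  where
  "smooth_subsampling sch X s b e n x \<omega> =
     (\<Sum>i<num_blocks sch b n. phi ((s b (block sch X b i \<omega>) - x) / e)) / real (num_blocks sch b n)"

definition abs_central_moment :: "'w measure \<Rightarrow> nat \<Rightarrow> ('w \<Rightarrow> real) \<Rightarrow> real" where
  "abs_central_moment M p U = \<bar>\<integral>\<omega>. (U \<omega> - (\<integral>\<omega>. U \<omega> \<partial>M)) ^ p \<partial>M\<bar>"

end

theory Submission
  imports Defs "HOL-Combinatorics.List_Permutation" "HOL-Combinatorics.Multiset_Permutations"
begin

text \<open>
  Let \<open>V\<^sub>i\<close> be the centred value of \<open>phi ((s\<^sub>b - x) / \<epsilon>)\<close> on the \<open>i\<close>-th block, so that the
  \<open>p\<close>-th central moment of the estimator is the expectation of \<open>(\<Sum>i<N. V\<^sub>i / N) ^ p\<close>. After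
  expanding the power and sorting the indices, it suffices to bound \<open>A\<^sub>q\<close>, the sum of
  \<open>\<bar>E (\<Prod>i\<leftarrow>xs. V\<^sub>i)\<bar>\<close> over the sorted \<open>q\<close>-tuples \<open>xs\<close> of block numbers, for \<open>q = p\<close>.

  Each sorted tuple is cut at its largest gap \<open>r\<close>. The expectation of the product is then the product
  of two expectations of lower order, up to a covariance that is at most some \<open>C r\<close>. Since at most
  \<open>(q - 1) N (r + 1) ^ (q - 2)\<close> tuples have largest gap \<open>r\<close>, this yields
  \<open>A\<^sub>q \<le> (\<Sum>m=1..<q. A\<^sub>m A\<^sub>q\<^sub>-\<^sub>m) + (q - 1) N (\<Sum>r<N. (r + 1) ^ (q - 2) * C r)\<close>
  (\<open>sum_sorted_tuples_max_gap_le\<close>). Weak dependence supplies \<open>C\<close>: a product of \<open>m\<close> block values is a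
  function of \<open>m b\<close> coordinates of the process with Lipschitz constant \<open>L b / \<epsilon>\<close>
  (\<open>Cov_prod_blocks_le\<close>). The summability condition on the coefficients and the rate condition then
  turn the recursion, for \<open>a\<^sub>q = A\<^sub>q / N ^ q\<close> and \<open>\<rho> = n powr - \<delta>\<close>, into
  \<open>a\<^sub>q \<le> D * \<rho> ^ (q - 1) + (\<Sum>m=1..<q. a\<^sub>m a\<^sub>q\<^sub>-\<^sub>m)\<close> with \<open>a\<^sub>1 = 0\<close>. Its solutions are of
  order \<open>\<rho> ^ k\<close> where \<open>k\<close> is \<open>q / 2\<close> rounded up (\<open>quadratic_recursion_bound\<close>).

  The four sets of hypotheses are treated together. The two notions of dependence differ by the factor
  \<open>\<kappa>\<close>, which is \<open>0\<close> or \<open>1\<close>, of the mixed term in the normalisation of the covariance. The two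
  schemes differ in the function \<open>C\<close> and in its weighted sum, which is of order
  \<open>\<tau> ^ (q - 1) * \<Lambda>\<close>, where \<open>\<Lambda>\<close> is the maximum in the rate condition, with \<open>\<tau> = b\<close> for overlapping
  and \<open>\<tau> = 1\<close> for non-overlapping blocks; since there are about \<open>n\<close> and \<open>n / b\<close> blocks respectively, \<open>\<tau> / N\<close> is of order \<open>b / n\<close> in both.

  If \<open>p\<close> is even and \<open>p \<delta> > 2\<close>, the moments are summable in \<open>n\<close>, so the estimator at a fixed \<open>x\<close>
  differs from its mean by a sequence that almost surely tends to \<open>0\<close>. By stationarity that mean lies
  between the values at \<open>x\<close> and at \<open>x + \<epsilon>\<close> of the distribution function of the statistic of size
  \<open>b\<close>, hence tends to \<open>K x\<close>. Convergence at countably many quantiles of \<open>K\<close> is uniform convergence,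
  because the estimator is monotone in \<open>x\<close> (\<open>polya_uniform_convergence\<close>).
\<close>

section \<open>Covariances under weak dependence\<close>

text \<open>
  The values \<open>\<kappa> = 0\<close> and \<open>\<kappa> = 1\<close> give the \<open>\<eta>\<close>- and the \<open>\<lambda>\<close>-coefficients, so every estimate below
  covers both notions of dependence.
\<close>
definition mixed_coeff :: "real \<Rightarrow> 'w measure \<Rightarrow> (int \<Rightarrow> 'w \<Rightarrow> real) \<Rightarrow> nat \<Rightarrow> ennreal" where
  "mixed_coeff \<kappa> = dep_coeff (\<lambda>u f v g. of_nat u * Lip u f + of_nat v * Lip v g
     + ennreal \<kappa> * (of_nat u * Lip u f) * (of_nat v * Lip v g))"

lemma eta_coeff_eq_mixed: "eta_coeff = mixed_coeff 0"
  by (simp add: eta_coeff_def mixed_coeff_def)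

lemma lambda_coeff_eq_mixed: "lambda_coeff = mixed_coeff 1"
  by (simp add: lambda_coeff_def mixed_coeff_def mult_ac)

text \<open>
  A real constant is easier to carry through products and rescalings than the extended real \<open>Lip\<close>,
  and it may be any upper bound.
\<close>
definition lipschitz_tuples :: "nat \<Rightarrow> real \<Rightarrow> ((nat \<Rightarrow> real) \<Rightarrow> real) \<Rightarrow> bool" where
  "lipschitz_tuples u A h \<longleftrightarrow> 0 \<le> A \<and>
     (\<forall>x \<in> {..<u} \<rightarrow>\<^sub>E UNIV. \<forall>y \<in> {..<u} \<rightarrow>\<^sub>E UNIV. \<bar>h y - h x\<bar> \<le> A * (\<Sum>i<u. \<bar>y i - x i\<bar>))"

lemma lipschitz_tuples_imp_Lip_le:
  assumes "lipschitz_tuples u A h"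
  shows "Lip u h \<le> ennreal A"
  unfolding Lip_def
proof (rule SUP_least, clarify)
  fix x y :: "nat \<Rightarrow> real"
  assume x: "x \<in> {..<u} \<rightarrow>\<^sub>E UNIV" and y: "y \<in> {..<u} \<rightarrow>\<^sub>E UNIV" and "x \<noteq> y"
  have A: "0 \<le> A" using assms by (simp add: lipschitz_tuples_def)
  have le: "\<bar>h y - h x\<bar> \<le> A * (\<Sum>i<u. \<bar>y i - x i\<bar>)"
    using assms x y by (auto simp: lipschitz_tuples_def)
  have "\<bar>h y - h x\<bar> / (\<Sum>i<u. \<bar>y i - x i\<bar>) \<le> A"
  proof (cases "(\<Sum>i<u. \<bar>y i - x i\<bar>) = 0")
    case True then show ?thesis using A by simp
  next
    case False
    then have "0 < (\<Sum>i<u. \<bar>y i - x i\<bar>)"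
      by (intro order.not_eq_order_implies_strict sum_nonneg) auto
    then show ?thesis using le by (simp add: pos_divide_le_eq)
  qed
  then show "ennreal (\<bar>h y - h x\<bar> / (\<Sum>i<u. norm (y i - x i))) \<le> ennreal A"
    by (simp add: ennreal_leI)
qed

lemma Lip_eq_imp_lipschitz_tuples:
  assumes L: "Lip u h = ennreal A" and A: "0 \<le> A"
  shows "lipschitz_tuples u A h"
  unfolding lipschitz_tuples_def
proof (intro conjI ballI A)
  fix x y :: "nat \<Rightarrow> real"
  assume x: "x \<in> {..<u} \<rightarrow>\<^sub>E UNIV" and y: "y \<in> {..<u} \<rightarrow>\<^sub>E UNIV"
  show "\<bar>h y - h x\<bar> \<le> A * (\<Sum>i<u. \<bar>y i - x i\<bar>)"
  proof (cases "x = y")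
    case True then show ?thesis by simp
  next
    case False
    have "ennreal (\<bar>h y - h x\<bar> / (\<Sum>i<u. \<bar>y i - x i\<bar>)) \<le> Lip u h"
      unfolding Lip_def by (rule SUP_upper2[of "(x, y)"]) (use x y False in auto)
    then have *: "\<bar>h y - h x\<bar> / (\<Sum>i<u. \<bar>y i - x i\<bar>) \<le> A"
      using L A by simp
    obtain i where "i < u" "x i \<noteq> y i"
      using False x y by (metis PiE_ext lessThan_iff)
    then have "0 < (\<Sum>i<u. \<bar>y i - x i\<bar>)"
      by (intro sum_pos2[of _ i]) auto
    then show ?thesis using * by (simp add: pos_divide_le_eq)
  qed
qed

text \<open>
  The dependence coefficients only speak of nondecreasing index tuples, whereas the indices of several
  overlapping blocks, listed block by block, are not in order.
\<close>
lemma ex_sorting_bijection: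
  fixes c :: "nat \<Rightarrow> int"
  obtains \<pi> s where "bij_betw \<pi> {..<u} {..<u}" "mono_on {..<u} s" "\<And>i. i < u \<Longrightarrow> c i = s (\<pi> i)"
proof -
  let ?xs = "map c [0..<u]"
  have "mset ?xs = mset (sort ?xs)" by simp
  then obtain f where f: "bij_betw f {..<length ?xs} {..<length (sort ?xs)}"
      "\<forall>i<length ?xs. ?xs ! i = sort ?xs ! f i"
    using permutation_Ex_bij by blast
  show thesis
  proof
    show "bij_betw f {..<u} {..<u}" using f(1) by simp
    show "mono_on {..<u} (\<lambda>i. sort ?xs ! i)"
      by (rule mono_onI) (auto intro!: sorted_nth_mono)
    show "c i = sort ?xs ! f i" if "i < u" for i using f(2) that by auto
  qed
qed

lemma lipschitz_tuples_reindex: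
  assumes f: "lipschitz_tuples u A f" and \<pi>: "bij_betw \<pi> {..<u} {..<u}" and "u \<le> u'"
  shows "lipschitz_tuples u' A (\<lambda>x. f (\<lambda>i\<in>{..<u}. x (\<pi> i)))"
  unfolding lipschitz_tuples_def
proof (intro conjI ballI)
  show A: "0 \<le> A" using f by (simp add: lipschitz_tuples_def)
  fix x y :: "nat \<Rightarrow> real"
  have "\<bar>f (\<lambda>i\<in>{..<u}. y (\<pi> i)) - f (\<lambda>i\<in>{..<u}. x (\<pi> i))\<bar> \<le> A * (\<Sum>i<u. \<bar>y (\<pi> i) - x (\<pi> i)\<bar>)"
    using f[unfolded lipschitz_tuples_def, THEN conjunct2, rule_format,
      of "\<lambda>i\<in>{..<u}. x (\<pi> i)" "\<lambda>i\<in>{..<u}. y (\<pi> i)"] by simp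
  also have "(\<Sum>i<u. \<bar>y (\<pi> i) - x (\<pi> i)\<bar>) = (\<Sum>i<u. \<bar>y i - x i\<bar>)"
    by (rule sum.reindex_bij_betw[OF \<pi>])
  also have "A * \<dots> \<le> A * (\<Sum>i<u'. \<bar>y i - x i\<bar>)"
    by (intro mult_left_mono sum_mono2 A) (use \<open>u \<le> u'\<close> in auto)
  finally show "\<bar>f (\<lambda>i\<in>{..<u}. y (\<pi> i)) - f (\<lambda>i\<in>{..<u}. x (\<pi> i))\<bar> \<le> A * (\<Sum>i<u'. \<bar>y i - x i\<bar>)" .
qed

lemma lipschitz_tuples_imp_test_fun:
  assumes "lipschitz_tuples u A f" and "\<And>x. \<bar>f x\<bar> \<le> 1"
  shows "test_fun u f"
proof -
  have "Lip u f < \<infinity>"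
    using lipschitz_tuples_imp_Lip_le[OF assms(1)] by (rule le_less_trans) simp
  then show ?thesis using assms(2) unfolding test_fun_def by blast
qed

text \<open>
  The coefficient at \<open>r\<close> is defined by gaps of exactly \<open>r\<close>, but up to a factor \<open>2\<close> it controls all
  larger gaps as well: one more coordinate, at distance \<open>r\<close> before the first index of the second tuple,
  can be appended to the first tuple and ignored by the function. This changes \<open>u\<close> to
  \<open>u + 1 \<le> 2 * u\<close> and leaves the Lipschitz constant alone.
\<close>
lemma Cov_le_mixed_coeff:
  fixes c d :: "nat \<Rightarrow> int"
  assumes e: "mixed_coeff \<kappa> M X r = ennreal e" and e0: "0 \<le> e" and \<kappa>: "0 \<le> \<kappa>"
    and u: "1 \<le> u" and v: "1 \<le> v"
    and sep: "\<And>i j. i < u \<Longrightarrow> j < v \<Longrightarrow> c i + int r \<le> d j"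
    and f: "lipschitz_tuples u A f" "\<And>x. \<bar>f x\<bar> \<le> 1"
    and g: "lipschitz_tuples v B g" "\<And>x. \<bar>g x\<bar> \<le> 1"
  shows "\<bar>Cov M (\<lambda>\<omega>. f (tuple X u c \<omega>)) (\<lambda>\<omega>. g (tuple X v d \<omega>))\<bar>
    \<le> 2 * e * (real u * A + real v * B + \<kappa> * (real u * A) * (real v * B))"
proof -
  have A: "0 \<le> A" and B: "0 \<le> B" using f(1) g(1) by (auto simp: lipschitz_tuples_def)
  obtain \<pi> s where \<pi>: "bij_betw \<pi> {..<u} {..<u}" and s: "mono_on {..<u} s"
    and cs: "\<And>i. i < u \<Longrightarrow> c i = s (\<pi> i)" using ex_sorting_bijection[of u c] by blast
  obtain \<sigma> t where \<sigma>: "bij_betw \<sigma> {..<v} {..<v}" and t: "mono_on {..<v} t"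
    and dt: "\<And>i. i < v \<Longrightarrow> d i = t (\<sigma> i)" using ex_sorting_bijection[of v d] by blast
  \<comment> \<open>the sorted indices, followed by the ignored coordinate\<close>
  define s' where "s' = (\<lambda>i. if i < u then s i else t 0 - int r)"
  define f' where "f' = (\<lambda>x. f (\<lambda>i\<in>{..<u}. x (\<pi> i)))"
  define g' where "g' = (\<lambda>x. g (\<lambda>i\<in>{..<v}. x (\<sigma> i)))"
  have \<pi>_less: "\<pi> i < u" if "i < u" for i using \<pi> that by (auto dest: bij_betwE)
  have \<sigma>_less: "\<sigma> i < v" if "i < v" for i using \<sigma> that by (auto dest: bij_betwE)
  have s_le: "s i \<le> t 0 - int r" if "i < u" for i
  proof -
    have "i \<in> \<pi> ` {..<u}" using that bij_betw_imp_surj_on[OF \<pi>] by simp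
    then obtain i' where i': "i' < u" "\<pi> i' = i" by auto
    have "0 \<in> \<sigma> ` {..<v}" using v bij_betw_imp_surj_on[OF \<sigma>] by simp
    then obtain j' where j': "j' < v" "\<sigma> j' = 0" by auto
    show ?thesis using sep[OF i'(1) j'(1)] cs[OF i'(1)] dt[OF j'(1)] i' j' by simp
  qed
  have s': "mono_on {..<Suc u} s'"
    using s s_le by (auto simp: mono_on_def s'_def)
  have f': "lipschitz_tuples (Suc u) A f'" unfolding f'_def
    by (rule lipschitz_tuples_reindex[OF f(1) \<pi>]) simp
  have g': "lipschitz_tuples v B g'" unfolding g'_def
    by (rule lipschitz_tuples_reindex[OF g(1) \<sigma>]) simp
  have f'_tuple: "f' (tuple X (Suc u) s' \<omega>) = f (tuple X u c \<omega>)" for \<omega>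
  proof -
    have "(\<lambda>i\<in>{..<u}. tuple X (Suc u) s' \<omega> (\<pi> i)) = tuple X u c \<omega>"
      unfolding tuple_def by (rule restrict_ext) (use \<pi>_less cs in \<open>auto simp: s'_def less_SucI\<close>)
    then show ?thesis by (simp only: f'_def)
  qed
  have g'_tuple: "g' (tuple X v t \<omega>) = g (tuple X v d \<omega>)" for \<omega>
  proof -
    have "(\<lambda>i\<in>{..<v}. tuple X v t \<omega> (\<sigma> i)) = tuple X v d \<omega>"
      unfolding tuple_def by (rule restrict_ext) (use \<sigma>_less dt in auto)
    then show ?thesis by (simp only: g'_def)
  qed
  define C where "C = \<bar>Cov M (\<lambda>\<omega>. f (tuple X u c \<omega>)) (\<lambda>\<omega>. g (tuple X v d \<omega>))\<bar>"
  define R where "R = real (Suc u) * A + real v * B + \<kappa> * (real (Suc u) * A) * (real v * B)"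
  define \<Psi> where "\<Psi> = of_nat (Suc u) * Lip (Suc u) f' + of_nat v * Lip v g'
     + ennreal \<kappa> * (of_nat (Suc u) * Lip (Suc u) f') * (of_nat v * Lip v g')"
  have gap: "t 0 - s' (Suc u - 1) = int r" by (simp add: s'_def)
  have tests: "test_fun (Suc u) f'" "test_fun v g'"
    using lipschitz_tuples_imp_test_fun[OF f'] lipschitz_tuples_imp_test_fun[OF g'] f(2) g(2)
    by (simp_all add: f'_def g'_def)
  have "ennreal C / \<Psi> \<le> mixed_coeff \<kappa> M X r"
    unfolding mixed_coeff_def dep_coeff_def \<Psi>_def C_def
    by (rule Sup_upper, rule CollectI, rule exI[of _ "Suc u"], rule exI[of _ v], rule exI[of _ s'],
        rule exI[of _ t], rule exI[of _ f'], rule exI[of _ g'])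
      (use v s' t gap tests in \<open>simp add: f'_tuple g'_tuple\<close>)
  then have quot: "ennreal C / \<Psi> \<le> ennreal e" using e by simp
  have "\<Psi> \<le> ennreal (real (Suc u)) * ennreal A + ennreal (real v) * ennreal B
     + ennreal \<kappa> * (ennreal (real (Suc u)) * ennreal A) * (ennreal (real v) * ennreal B)"
    unfolding \<Psi>_def ennreal_of_nat_eq_real_of_nat
    by (intro add_mono mult_mono order_refl lipschitz_tuples_imp_Lip_le f' g') auto
  also have "\<dots> = ennreal R"
    unfolding R_def using A B \<kappa> by (simp flip: ennreal_mult ennreal_plus)
  finally have \<Psi>_le: "\<Psi> \<le> ennreal R" .
  then have \<Psi>_fin: "\<Psi> < \<top>" by (rule le_less_trans) simp
  \<comment> \<open>if the normalisation vanishes, the finite coefficient forces the covariance to be zero\<close>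
  have "ennreal C \<le> ennreal e * \<Psi>"
  proof (cases "\<Psi> = 0")
    case True
    then have "ennreal C = 0" using quot
      by (cases "ennreal C = 0") (auto simp: divide_ennreal_def ennreal_mult_top top_unique)
    then show ?thesis by simp
  next
    case False
    have "ennreal C = ennreal C / \<Psi> * \<Psi>"
      using False \<Psi>_fin by (simp add: ennreal_divide_times ennreal_mult_divide_eq less_top[symmetric])
    also have "\<dots> \<le> ennreal e * \<Psi>" by (intro mult_right_mono quot) simp
    finally show ?thesis .
  qed
  also have "\<dots> \<le> ennreal e * ennreal R" by (intro mult_left_mono \<Psi>_le) simp
  also have "\<dots> = ennreal (e * R)" using e0 by (simp add: ennreal_mult')
  finally have "C \<le> e * R"
    by (subst (asm) ennreal_le_iff) (use A B e0 \<kappa> in \<open>simp_all add: R_def\<close>)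
  also have "R \<le> 2 * (real u * A + real v * B + \<kappa> * (real u * A) * (real v * B))"
  proof -
    have "real (Suc u) * A \<le> 2 * (real u * A)"
      using u A mult_right_mono[of "real (Suc u)" "2 * real u" A] by simp
    moreover have "\<kappa> * (real (Suc u) * A) * (real v * B) \<le> \<kappa> * (2 * (real u * A)) * (real v * B)"
      by (intro mult_right_mono mult_left_mono) (use calculation A B \<kappa> in auto)
    moreover have "0 \<le> real v * B" using B by simp
    ultimately show ?thesis unfolding R_def by (simp add: algebra_simps)
  qed
  then have "e * R \<le> e * (2 * (real u * A + real v * B + \<kappa> * (real u * A) * (real v * B)))"
    using e0 by (rule mult_left_mono)
  finally show ?thesis unfolding C_def by (simp add: mult_ac)
qed

text \<open>
  For factors bounded by \<open>1\<close>, the increment of a product is at most the sum of the increments. The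
  factors depend on disjoint sets of coordinates, so the Lipschitz constant does not grow with their
  number.
\<close>
lemma lipschitz_tuples_prod_blocks:
  assumes G: "\<And>k. k < m \<Longrightarrow> lipschitz_tuples b l (G k)" "\<And>k x. k < m \<Longrightarrow> \<bar>G k x\<bar> \<le> 1" and l: "0 \<le> l"
  shows "lipschitz_tuples (m * b) l (\<lambda>x. \<Prod>k<m. G k (\<lambda>j\<in>{..<b}. x (k * b + j)))"
  unfolding lipschitz_tuples_def
proof (intro conjI ballI l)
  fix x y :: "nat \<Rightarrow> real"
  let ?R = "\<lambda>x k. (\<lambda>j\<in>{..<b}. x (k * b + j)) :: nat \<Rightarrow> real"
  have "\<bar>(\<Prod>k<m. G k (?R y k)) - (\<Prod>k<m. G k (?R x k))\<bar>
      \<le> (\<Sum>k<m. \<bar>G k (?R y k) - G k (?R x k)\<bar>)"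
    using norm_prod_diff[of "{..<m}" "\<lambda>k. G k (?R y k)" "\<lambda>k. G k (?R x k)"] G(2) by simp
  also have "\<dots> \<le> (\<Sum>k<m. l * (\<Sum>j<b. \<bar>y (k * b + j) - x (k * b + j)\<bar>))"
  proof (rule sum_mono)
    fix k assume "k \<in> {..<m}"
    then have "lipschitz_tuples b l (G k)" using G(1) by simp
    moreover have "?R x k \<in> {..<b} \<rightarrow>\<^sub>E UNIV" "?R y k \<in> {..<b} \<rightarrow>\<^sub>E UNIV" by auto
    ultimately have "\<bar>G k (?R y k) - G k (?R x k)\<bar> \<le> l * (\<Sum>j<b. \<bar>?R y k j - ?R x k j\<bar>)"
      unfolding lipschitz_tuples_def by blast
    then show "\<bar>G k (?R y k) - G k (?R x k)\<bar> \<le> l * (\<Sum>j<b. \<bar>y (k * b + j) - x (k * b + j)\<bar>)"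
      by simp
  qed
  also have "\<dots> = l * (\<Sum>k<m. \<Sum>j<b. \<bar>y (k * b + j) - x (k * b + j)\<bar>)"
    by (simp add: sum_distrib_left)
  also have "(\<Sum>k<m. \<Sum>j<b. \<bar>y (k * b + j) - x (k * b + j)\<bar>) =
      (\<Sum>k<m. \<Sum>i\<in>{k * b..<k * b + b}. \<bar>y i - x i\<bar>)"
  proof (rule sum.cong[OF refl])
    fix k
    show "(\<Sum>j<b. \<bar>y (k * b + j) - x (k * b + j)\<bar>) = (\<Sum>i\<in>{k * b..<k * b + b}. \<bar>y i - x i\<bar>)"
      by (rule sum.reindex_bij_witness[of _ "\<lambda>i. i - k * b" "\<lambda>j. k * b + j"]) auto
  qed
  also have "\<dots> = (\<Sum>i<m * b. \<bar>y i - x i\<bar>)" by (rule sum.nat_group)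
  finally show "\<bar>(\<Prod>k<m. G k (?R y k)) - (\<Prod>k<m. G k (?R x k))\<bar> \<le> l * (\<Sum>i<m * b. \<bar>y i - x i\<bar>)" .
qed

text \<open>
  Coordinate \<open>k * b + j\<close> of the long tuple is the \<open>j\<close>-th observation of the block listed at position
  \<open>k\<close>. Observations shared by overlapping blocks are repeated, which the definition of the coefficients
  permits.
\<close>
lemma Cov_prod_blocks_le:
  fixes G :: "nat \<Rightarrow> (nat \<Rightarrow> real) \<Rightarrow> real" and a :: "nat \<Rightarrow> int"
  assumes e: "mixed_coeff \<kappa> M X r = ennreal e" and e0: "0 \<le> e" and \<kappa>: "0 \<le> \<kappa>"
    and G: "\<And>i. lipschitz_tuples b l (G i)" "\<And>i x. \<bar>G i x\<bar> \<le> 1" and b: "1 \<le> b"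
    and ne: "xs \<noteq> []" "ys \<noteq> []"
    and sep: "\<And>i j. i \<in> set xs \<Longrightarrow> j \<in> set ys \<Longrightarrow> a i + int b - 1 + int r \<le> a j"
  shows "\<bar>Cov M (\<lambda>\<omega>. \<Prod>i\<leftarrow>xs. G i (tuple X b (\<lambda>j. a i + int j) \<omega>))
                (\<lambda>\<omega>. \<Prod>i\<leftarrow>ys. G i (tuple X b (\<lambda>j. a i + int j) \<omega>))\<bar>
    \<le> 2 * e * (real (length xs * b) * l + real (length ys * b) * l
        + \<kappa> * (real (length xs * b) * l) * (real (length ys * b) * l))"
proof -
  have l: "0 \<le> l" using G(1) by (auto simp: lipschitz_tuples_def)
  define F where "F = (\<lambda>zs (x :: nat \<Rightarrow> real). \<Prod>k<length zs. G (zs ! k) (\<lambda>j\<in>{..<b}. x (k * b + j)))"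
  define c where "c = (\<lambda>zs i. a (zs ! (i div b)) + int (i mod b))"
  have F_tuple: "(\<Prod>i\<leftarrow>zs. G i (tuple X b (\<lambda>j. a i + int j) \<omega>)) = F zs (tuple X (length zs * b) (c zs) \<omega>)"
    for zs \<omega>
  proof -
    have "(\<lambda>j\<in>{..<b}. tuple X (length zs * b) (c zs) \<omega> (k * b + j)) = tuple X b (\<lambda>j. a (zs ! k) + int j) \<omega>"
      if "k < length zs" for k
    proof -
      have "k * b + j < length zs * b" if "j < b" for j
      proof -
        have "k * b + j < Suc k * b" using that by simp
        also have "\<dots> \<le> length zs * b" using \<open>k < length zs\<close> by (intro mult_le_mono1) simp
        finally show ?thesis .
      qed
      then show ?thesis by (auto simp: tuple_def c_def fun_eq_iff)
    qed
    then show ?thesis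
      by (simp add: F_def prod.list_conv_set_nth atLeast0LessThan)
  qed
  have F: "lipschitz_tuples (length zs * b) l (F zs)" for zs
    unfolding F_def by (rule lipschitz_tuples_prod_blocks) (use G l in auto)
  have F1: "\<bar>F zs x\<bar> \<le> 1" for zs x
    unfolding F_def abs_prod by (intro prod_le_1) (auto simp: G(2))
  show ?thesis unfolding F_tuple
  proof (rule Cov_le_mixed_coeff[OF e e0 \<kappa> _ _ _ F F1 F F1])
    show "1 \<le> length xs * b" "1 \<le> length ys * b" using b ne by (simp_all add: Suc_le_eq)
    show "c xs i + int r \<le> c ys j" if "i < length xs * b" "j < length ys * b" for i j
    proof -
      have "i div b < length xs" "j div b < length ys"
        using that by (auto simp: less_mult_imp_div_less)
      then have "a (xs ! (i div b)) + int b - 1 + int r \<le> a (ys ! (j div b))"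
        by (intro sep) auto
      moreover have "i mod b < b" using b by simp
      ultimately show ?thesis unfolding c_def by linarith
    qed
  qed
qed

section \<open>Sums over sorted tuples\<close>

definition sorted_tuples :: "nat \<Rightarrow> nat \<Rightarrow> nat list set" where
  "sorted_tuples N q = {xs. sorted xs \<and> set xs \<subseteq> {..<N} \<and> length xs = q}"

lemma finite_sorted_tuples [simp]: "finite (sorted_tuples N q)"
  by (rule finite_subset[OF _ finite_lists_length_eq[of "{..<N}" q]]) (auto simp: sorted_tuples_def)

lemma power_sum_eq_sum_lists:
  fixes v :: "nat \<Rightarrow> 'a::comm_semiring_1"
  shows "(\<Sum>i<N. v i) ^ q = (\<Sum>xs | set xs \<subseteq> {..<N} \<and> length xs = q. \<Prod>i\<leftarrow>xs. v i)"
proof (induction q)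
  case 0
  have "{xs :: nat list. set xs \<subseteq> {..<N} \<and> length xs = 0} = {[]}" by auto
  then show ?case by (simp del: length_0_conv)
next
  case (Suc q)
  let ?S = "{xs. set xs \<subseteq> {..<N} \<and> length xs = q}"
  have "(\<Sum>i<N. v i) ^ Suc q = (\<Sum>xs\<in>?S. \<Prod>i\<leftarrow>xs. v i) * (\<Sum>i<N. v i)"
    by (simp add: Suc mult.commute)
  also have "\<dots> = (\<Sum>(xs, i)\<in>?S \<times> {..<N}. (\<Prod>i\<leftarrow>xs. v i) * v i)"
    by (simp add: sum_product sum.cartesian_product)
  also have "\<dots> = (\<Sum>xs\<in>(\<lambda>(xs, i). i # xs) ` (?S \<times> {..<N}). \<Prod>i\<leftarrow>xs. v i)"
    by (subst sum.reindex) (auto simp: inj_on_def mult.commute intro!: sum.cong)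
  also have "(\<lambda>(xs, i). i # xs) ` (?S \<times> {..<N}) = {xs. set xs \<subseteq> {..<N} \<and> length xs = Suc q}"
    by (rule lists_length_Suc_eq[symmetric])
  finally show ?case .
qed

text \<open>
  At most \<open>q!\<close> lists of length \<open>q\<close> have the same sorted version.
\<close>
lemma sum_sort_le:
  fixes g :: "nat list \<Rightarrow> real"
  assumes g: "\<And>xs. 0 \<le> g xs"
  shows "(\<Sum>xs | set xs \<subseteq> {..<N} \<and> length xs = q. g (sort xs)) \<le> fact q * (\<Sum>ys\<in>sorted_tuples N q. g ys)"
proof -
  let ?S = "{xs. set xs \<subseteq> {..<N} \<and> length xs = q}"
  have finS: "finite ?S" by (rule finite_lists_length_eq) simp
  have "(\<Sum>xs\<in>?S. g (sort xs)) = (\<Sum>ys\<in>sorted_tuples N q. \<Sum>xs | xs \<in> ?S \<and> sort xs = ys. g (sort xs))"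
    by (rule sum.group[OF finS finite_sorted_tuples, symmetric]) (auto simp: sorted_tuples_def)
  also have "\<dots> \<le> (\<Sum>ys\<in>sorted_tuples N q. fact q * g ys)"
  proof (rule sum_mono)
    fix ys assume ys: "ys \<in> sorted_tuples N q"
    have "{xs. xs \<in> ?S \<and> sort xs = ys} \<subseteq> permutations_of_multiset (mset ys)"
      by (auto simp: permutations_of_multiset_def)
    then have "card {xs. xs \<in> ?S \<and> sort xs = ys} \<le> card (permutations_of_multiset (mset ys))"
      by (intro card_mono) auto
    also have "\<dots> \<le> fact q"
      using ys by (simp add: card_permutations_of_multiset sorted_tuples_def div_le_dividend)
    finally have "real (card {xs. xs \<in> ?S \<and> sort xs = ys}) \<le> real (fact q)"
      by (rule of_nat_mono)
    then have card: "real (card {xs. xs \<in> ?S \<and> sort xs = ys}) \<le> fact q"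
      by (simp only: of_nat_fact)
    have "(\<Sum>xs | xs \<in> ?S \<and> sort xs = ys. g (sort xs)) = (\<Sum>xs | xs \<in> ?S \<and> sort xs = ys. g ys)"
      by (rule sum.cong) auto
    also have "\<dots> = real (card {xs. xs \<in> ?S \<and> sort xs = ys}) * g ys" by simp
    also have "\<dots> \<le> fact q * g ys" by (rule mult_right_mono[OF card g])
    finally show "(\<Sum>xs | xs \<in> ?S \<and> sort xs = ys. g (sort xs)) \<le> fact q * g ys" .
  qed
  finally show ?thesis by (simp add: sum_distrib_left)
qed

text \<open>
  A list is determined by its first entry and its successive increments. This is the counting behind
  the factor \<open>N (r + 1) ^ (q - 2)\<close>: if the largest of the \<open>q - 1\<close> gaps is \<open>r\<close> and its place is given,
  each of the other gaps has \<open>r + 1\<close> possible values.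
\<close>
lemma card_gap_lists_le:
  fixes G :: "nat \<Rightarrow> nat set" and N :: nat
  assumes G: "\<And>i. finite (G i)"
  defines "T \<equiv> \<lambda>k. {xs. length xs = Suc k \<and> xs ! 0 < N \<and> (\<forall>i<k. \<exists>g\<in>G i. xs ! Suc i = xs ! i + g)}"
  shows "finite (T k) \<and> card (T k) \<le> N * (\<Prod>i<k. card (G i))"
proof (induction k)
  case 0
  have "T 0 = (\<lambda>i. [i]) ` {..<N}" by (auto simp: T_def length_Suc_conv)
  then show ?case using card_image_le[of "{..<N}" "\<lambda>i. [i]"] by simp
next
  case (Suc k)
  have sub: "T (Suc k) \<subseteq> (\<lambda>(xs, g). xs @ [last xs + g]) ` (T k \<times> G k)"
  proof
    fix xs assume xs: "xs \<in> T (Suc k)"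
    then obtain g where g: "g \<in> G k" "xs ! Suc k = xs ! k + g" unfolding T_def by auto
    have len: "length xs = Suc (Suc k)" using xs by (simp add: T_def)
    then have ne: "xs \<noteq> []" "butlast xs \<noteq> []" by (auto simp flip: length_0_conv)
    have last: "last xs = last (butlast xs) + g"
      using g len ne by (simp add: last_conv_nth nth_butlast)
    have "butlast xs \<in> T k"
      using xs len by (auto simp: T_def nth_butlast)
    moreover have "xs = butlast xs @ [last (butlast xs) + g]"
      using append_butlast_last_id[OF ne(1)] last by simp
    ultimately show "xs \<in> (\<lambda>(xs, g). xs @ [last xs + g]) ` (T k \<times> G k)"
      using g(1) by (metis (no_types, lifting) SigmaI case_prod_conv image_eqI)
  qed
  have fin: "finite (T k \<times> G k)" using Suc G by blast
  then have "card (T (Suc k)) \<le> card (T k \<times> G k)"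
    using sub by (meson surj_card_le)
  also have "\<dots> \<le> (N * (\<Prod>i<k. card (G i))) * card (G k)"
    using Suc by (simp add: card_cartesian_product)
  finally show ?case using finite_subset[OF sub] fin by (simp add: mult.assoc)
qed

lemma card_max_gap_le:
  assumes m: "1 \<le> m" "m < q"
  shows "card {xs \<in> sorted_tuples N q. xs ! m - xs ! (m - 1) = r \<and> (\<forall>i\<in>{1..<q}. xs ! i - xs ! (i - 1) \<le> r)}
    \<le> N * (r + 1) ^ (q - 2)" (is "card ?T \<le> _")
proof -
  define G where "G = (\<lambda>i. if i = m - 1 then {r} else {..r})"
  define k where "k = q - 1"
  let ?U = "{xs. length xs = Suc k \<and> xs ! 0 < N \<and> (\<forall>i<k. \<exists>g\<in>G i. xs ! Suc i = xs ! i + g)}"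
  have "finite (G i)" for i by (simp add: G_def)
  from card_gap_lists_le[of G k N, OF this]
  have U: "finite ?U" "card ?U \<le> N * (\<Prod>i<k. card (G i))" by auto
  have "?T \<subseteq> ?U"
  proof
    fix xs assume xs: "xs \<in> ?T"
    then have srt: "sorted xs" and len: "length xs = q" and less: "set xs \<subseteq> {..<N}"
      and gap: "xs ! m - xs ! (m - 1) = r" and gaps: "\<And>i. i \<in> {1..<q} \<Longrightarrow> xs ! i - xs ! (i - 1) \<le> r"
      by (auto simp: sorted_tuples_def)
    have "xs ! 0 \<in> set xs" using len m by (intro nth_mem) auto
    then have "xs ! 0 < N" using less by auto
    moreover have "\<exists>g\<in>G i. xs ! Suc i = xs ! i + g" if "i < k" for i
    proof (intro bexI)
      show "xs ! Suc i = xs ! i + (xs ! Suc i - xs ! i)"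
        using sorted_nth_mono[OF srt, of i "Suc i"] len that by (simp add: k_def)
      show "xs ! Suc i - xs ! i \<in> G i"
        using gap gaps[of "Suc i"] that m by (auto simp: G_def k_def)
    qed
    ultimately show "xs \<in> ?U" using len m by (auto simp: k_def)
  qed
  then have "card ?T \<le> card ?U" using U(1) by (rule card_mono[rotated])
  also have "\<dots> \<le> N * (\<Prod>i<k. card (G i))" by (rule U(2))
  also have "(\<Prod>i<k. card (G i)) = card (G (m - 1)) * (\<Prod>i\<in>{..<k} - {m - 1}. card (G i))"
    by (rule prod.remove) (use m in \<open>auto simp: k_def\<close>)
  also have "(\<Prod>i\<in>{..<k} - {m - 1}. card (G i)) = (\<Prod>i\<in>{..<k} - {m - 1}. r + 1)"
    by (rule prod.cong) (auto simp: G_def)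
  also have "card (G (m - 1)) * \<dots> = (r + 1) ^ (q - 2)"
    using m by (simp add: G_def k_def card_Diff_singleton numeral_2_eq_2)
  finally show ?thesis .
qed

lemma sum_split_sorted_tuples_le:
  fixes g h :: "nat list \<Rightarrow> real"
  assumes g: "\<And>xs. 0 \<le> g xs" "\<And>xs. 0 \<le> h xs" and m: "m \<le> q"
  shows "(\<Sum>xs\<in>sorted_tuples N q. g (take m xs) * h (drop m xs))
    \<le> (\<Sum>xs\<in>sorted_tuples N m. g xs) * (\<Sum>xs\<in>sorted_tuples N (q - m). h xs)"
proof -
  let ?f = "\<lambda>xs :: nat list. (take m xs, drop m xs)"
  have inj: "inj_on ?f A" for A
    by (rule inj_onI) (metis append_take_drop_id prod.inject)
  have "(\<Sum>xs\<in>sorted_tuples N q. g (take m xs) * h (drop m xs))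
      = (\<Sum>(ys, zs)\<in>?f ` sorted_tuples N q. g ys * h zs)"
    by (subst sum.reindex[OF inj]) simp
  also have "\<dots> \<le> (\<Sum>(ys, zs)\<in>sorted_tuples N m \<times> sorted_tuples N (q - m). g ys * h zs)"
  proof (rule sum_mono2)
    show "?f ` sorted_tuples N q \<subseteq> sorted_tuples N m \<times> sorted_tuples N (q - m)"
      using m by (auto simp: sorted_tuples_def dest!: in_set_takeD in_set_dropD)
  qed (use g in auto)
  also have "\<dots> = (\<Sum>xs\<in>sorted_tuples N m. g xs) * (\<Sum>xs\<in>sorted_tuples N (q - m). h xs)"
    by (simp add: sum_product sum.cartesian_product)
  finally show ?thesis .
qed

text \<open>
  Each tuple is split only at the place of its largest gap; the bound pays for all \<open>q - 1\<close> possible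
  places. In the application \<open>\<mu> xs\<close> is the expectation of a product over \<open>xs\<close>.
\<close>
lemma sum_sorted_tuples_max_gap_le:
  fixes \<mu> :: "nat list \<Rightarrow> real" and C :: "nat \<Rightarrow> real"
  assumes q: "2 \<le> q" and C: "\<And>r. 0 \<le> C r"
    and split: "\<And>xs m. xs \<in> sorted_tuples N q \<Longrightarrow> 1 \<le> m \<Longrightarrow> m < q \<Longrightarrow>
      \<bar>\<mu> xs - \<mu> (take m xs) * \<mu> (drop m xs)\<bar> \<le> C (xs ! m - xs ! (m - 1))"
  defines "A \<equiv> \<lambda>k. \<Sum>xs\<in>sorted_tuples N k. \<bar>\<mu> xs\<bar>"
  shows "A q \<le> (\<Sum>m\<in>{1..<q}. A m * A (q - m)) + real (q - 1) * real N * (\<Sum>r<N. real (r + 1) ^ (q - 2) * C r)"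
proof -
  let ?S = "sorted_tuples N q"
  define T where "T = (\<lambda>m r. {xs \<in> ?S. xs ! m - xs ! (m - 1) = r \<and> (\<forall>i\<in>{1..<q}. xs ! i - xs ! (i - 1) \<le> r)})"
  have step: "\<bar>\<mu> xs\<bar> \<le> (\<Sum>m\<in>{1..<q}. \<bar>\<mu> (take m xs)\<bar> * \<bar>\<mu> (drop m xs)\<bar>)
      + (\<Sum>m\<in>{1..<q}. \<Sum>r<N. of_bool (xs \<in> T m r) * C r)" if xs: "xs \<in> ?S" for xs
  proof -
    let ?gap = "\<lambda>m. xs ! m - xs ! (m - 1)"
    have "Max (?gap ` {1..<q}) \<in> ?gap ` {1..<q}" by (rule Max_in) (use q in auto)
    then obtain m where m: "m \<in> {1..<q}" "Max (?gap ` {1..<q}) = ?gap m" by auto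
    have max: "?gap i \<le> ?gap m" if "i \<in> {1..<q}" for i
      unfolding m(2)[symmetric] by (rule Max_ge) (use that in auto)
    have "xs ! m \<in> set xs" using m xs by (intro nth_mem) (auto simp: sorted_tuples_def)
    then have "xs ! m < N" using xs by (auto simp: sorted_tuples_def)
    then have r: "?gap m \<in> {..<N}" by auto
    have inT: "xs \<in> T m (?gap m)" using xs max by (auto simp: T_def)
    have "\<bar>\<mu> xs\<bar> \<le> \<bar>\<mu> (take m xs)\<bar> * \<bar>\<mu> (drop m xs)\<bar> + C (?gap m)"
      using split[OF xs, of m] m(1) by (simp flip: abs_mult)
    also have "\<bar>\<mu> (take m xs)\<bar> * \<bar>\<mu> (drop m xs)\<bar> \<le> (\<Sum>m\<in>{1..<q}. \<bar>\<mu> (take m xs)\<bar> * \<bar>\<mu> (drop m xs)\<bar>)"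
      by (rule member_le_sum[OF m(1), where f = "\<lambda>m. \<bar>\<mu> (take m xs)\<bar> * \<bar>\<mu> (drop m xs)\<bar>"]) auto
    also have "C (?gap m) \<le> (\<Sum>r<N. of_bool (xs \<in> T m r) * C r)"
      using member_le_sum[OF r, of "\<lambda>r. of_bool (xs \<in> T m r) * C r"] inT C by simp
    also have "\<dots> \<le> (\<Sum>m\<in>{1..<q}. \<Sum>r<N. of_bool (xs \<in> T m r) * C r)"
      by (rule member_le_sum[OF m(1), where f = "\<lambda>m. \<Sum>r<N. of_bool (xs \<in> T m r) * C r"])
        (auto intro!: sum_nonneg mult_nonneg_nonneg C)
    finally show ?thesis by simp
  qed
  have "A q \<le> (\<Sum>xs\<in>?S. (\<Sum>m\<in>{1..<q}. \<bar>\<mu> (take m xs)\<bar> * \<bar>\<mu> (drop m xs)\<bar>)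
      + (\<Sum>m\<in>{1..<q}. \<Sum>r<N. of_bool (xs \<in> T m r) * C r))"
    unfolding A_def by (rule sum_mono[OF step])
  also have "\<dots> = (\<Sum>m\<in>{1..<q}. \<Sum>xs\<in>?S. \<bar>\<mu> (take m xs)\<bar> * \<bar>\<mu> (drop m xs)\<bar>)
      + (\<Sum>m\<in>{1..<q}. \<Sum>xs\<in>?S. \<Sum>r<N. of_bool (xs \<in> T m r) * C r)"
    by (simp only: sum.distrib sum.swap[of _ "{1..<q}" ?S])
  also have "(\<Sum>m\<in>{1..<q}. \<Sum>xs\<in>?S. \<bar>\<mu> (take m xs)\<bar> * \<bar>\<mu> (drop m xs)\<bar>) \<le> (\<Sum>m\<in>{1..<q}. A m * A (q - m))"
    unfolding A_def by (intro sum_mono sum_split_sorted_tuples_le) auto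
  also have "(\<Sum>m\<in>{1..<q}. \<Sum>xs\<in>?S. \<Sum>r<N. of_bool (xs \<in> T m r) * C r)
      \<le> (\<Sum>m\<in>{1..<q}. \<Sum>r<N. real N * (real (r + 1) ^ (q - 2) * C r))"
  proof (rule sum_mono)
    fix m assume m: "m \<in> {1..<q}"
    have "(\<Sum>xs\<in>?S. \<Sum>r<N. of_bool (xs \<in> T m r) * C r) = (\<Sum>r<N. (\<Sum>xs\<in>?S. of_bool (xs \<in> T m r)) * C r)"
      by (subst sum.swap) (simp add: sum_distrib_right)
    also have "\<dots> = (\<Sum>r<N. real (card (T m r)) * C r)"
    proof -
      have "?S \<inter> {xs. xs \<in> T m r} = T m r" for r by (auto simp: T_def)
      then show ?thesis by (simp add: sum_of_bool_eq)
    qed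
    also have "\<dots> \<le> (\<Sum>r<N. real (N * (r + 1) ^ (q - 2)) * C r)"
    proof (intro sum_mono mult_right_mono C of_nat_mono)
      fix r show "card (T m r) \<le> N * (r + 1) ^ (q - 2)"
        unfolding T_def by (rule card_max_gap_le) (use m in auto)
    qed
    finally show "(\<Sum>xs\<in>?S. \<Sum>r<N. of_bool (xs \<in> T m r) * C r) \<le> (\<Sum>r<N. real N * (real (r + 1) ^ (q - 2) * C r))"
      by (simp add: mult.assoc)
  qed
  also have "(\<Sum>m\<in>{1..<q}. \<Sum>r<N. real N * (real (r + 1) ^ (q - 2) * C r))
      = real (q - 1) * real N * (\<Sum>r<N. real (r + 1) ^ (q - 2) * C r)"
    by (simp add: sum_distrib_left mult.assoc)
  finally show ?thesis by simp
qed

text \<open>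
  The product does not depend on the order of the indices, so unsorted tuples can be replaced by sorted
  ones.
\<close>
lemma (in prob_space) abs_expectation_power_sum_le:
  fixes V :: "nat \<Rightarrow> 'a \<Rightarrow> real"
  assumes V: "\<And>i. V i \<in> borel_measurable M" "\<And>i \<omega>. \<bar>V i \<omega>\<bar> \<le> 1"
  shows "\<bar>expectation (\<lambda>\<omega>. (\<Sum>i<N. V i \<omega>) ^ q)\<bar>
    \<le> fact q * (\<Sum>xs\<in>sorted_tuples N q. \<bar>expectation (\<lambda>\<omega>. \<Prod>i\<leftarrow>xs. V i \<omega>)\<bar>)"
proof -
  let ?S = "{xs. set xs \<subseteq> {..<N} \<and> length xs = q}"
  let ?\<mu> = "\<lambda>xs. expectation (\<lambda>\<omega>. \<Prod>i\<leftarrow>xs. V i \<omega>)"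
  have meas: "(\<lambda>\<omega>. \<Prod>i\<leftarrow>xs. V i \<omega>) \<in> borel_measurable M" for xs
    by (induction xs) (auto intro!: borel_measurable_times V)
  have bound: "\<bar>\<Prod>i\<leftarrow>xs. V i \<omega>\<bar> \<le> 1" for xs \<omega>
    by (induction xs) (auto simp: abs_mult intro!: mult_le_one V)
  have int: "integrable M (\<lambda>\<omega>. \<Prod>i\<leftarrow>xs. V i \<omega>)" for xs
    by (rule integrable_const_bound[of _ 1]) (use meas bound in auto)
  have sort: "?\<mu> (sort xs) = ?\<mu> xs" for xs
  proof -
    have "(\<Prod>i\<leftarrow>sort xs. V i \<omega>) = (\<Prod>i\<leftarrow>xs. V i \<omega>)" for \<omega>
      by (simp flip: prod_mset_prod_list)
    then show ?thesis by simp
  qed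
  have "expectation (\<lambda>\<omega>. (\<Sum>i<N. V i \<omega>) ^ q) = (\<Sum>xs\<in>?S. ?\<mu> xs)"
    unfolding power_sum_eq_sum_lists by (rule Bochner_Integration.integral_sum) (rule int)
  also have "\<bar>\<dots>\<bar> \<le> (\<Sum>xs\<in>?S. \<bar>?\<mu> xs\<bar>)" by (rule sum_abs)
  also have "\<dots> = (\<Sum>xs\<in>?S. \<bar>?\<mu> (sort xs)\<bar>)" by (simp add: sort)
  also have "\<dots> \<le> fact q * (\<Sum>xs\<in>sorted_tuples N q. \<bar>?\<mu> xs\<bar>)"
    by (rule sum_sort_le) simp
  finally show ?thesis .
qed

text \<open>
  By induction, the products on the right are of order \<open>\<rho> ^ (\<lceil>m / 2\<rceil> + \<lceil>(q - m) / 2\<rceil>)\<close>, an exponent of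
  at least \<open>\<lceil>q / 2\<rceil>\<close>. Rounding up is essential: the exponents \<open>\<lfloor>m / 2\<rfloor>\<close> would lose a factor \<open>\<rho>\<close>
  whenever \<open>q\<close> is even and \<open>m\<close> odd. The induction can start because \<open>a 1 = 0\<close>, and \<open>q - 1 \<ge> \<lceil>q / 2\<rceil>\<close> for
  \<open>q \<ge> 2\<close> takes care of the inhomogeneous term.
\<close>
lemma quadratic_recursion_bound:
  assumes D: "0 \<le> (D :: real)" and "1 \<le> p"
  shows "\<exists>K\<ge>0. \<forall>a \<rho>. 0 \<le> \<rho> \<longrightarrow> \<rho> \<le> 1 \<longrightarrow> a 1 = 0 \<longrightarrow> (\<forall>q. 0 \<le> a q) \<longrightarrow>
    (\<forall>q. 2 \<le> q \<longrightarrow> q \<le> p \<longrightarrow> a q \<le> D * \<rho> ^ (q - 1) + (\<Sum>m\<in>{1..<q}. a m * a (q - m))) \<longrightarrow>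
    a p \<le> K * \<rho> ^ ((p + 1) div 2)"
  using \<open>1 \<le> p\<close>
proof (induction p rule: less_induct)
  case (less p)
  show ?case
  proof (cases "p = 1")
    case True
    show ?thesis by (rule exI[of _ 0]) (simp add: True)
  next
    case False
    then have p: "2 \<le> p" using less.prems by simp
    define P where "P = (\<lambda>m K. 0 \<le> K \<and> (\<forall>a \<rho>. 0 \<le> \<rho> \<longrightarrow> \<rho> \<le> 1 \<longrightarrow> a 1 = 0 \<longrightarrow> (\<forall>q. 0 \<le> a q) \<longrightarrow>
      (\<forall>q. 2 \<le> q \<longrightarrow> q \<le> m \<longrightarrow> a q \<le> D * \<rho> ^ (q - 1) + (\<Sum>m\<in>{1..<q}. a m * a (q - m))) \<longrightarrow>
      a m \<le> K * \<rho> ^ ((m + 1) div 2)))"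
    have "\<exists>K. P m K" if "m \<in> {1..<p}" for m
      using less.IH[of m] that unfolding P_def by auto
    then obtain K where K: "\<And>m. m \<in> {1..<p} \<Longrightarrow> P m (K m)" by metis
    have K0: "0 \<le> K m" if "m \<in> {1..<p}" for m using K[OF that] by (simp add: P_def)
    show ?thesis
    proof (intro exI conjI allI impI)
      show "0 \<le> D + (\<Sum>m\<in>{1..<p}. K m * K (p - m))"
        by (intro add_nonneg_nonneg D sum_nonneg mult_nonneg_nonneg K0) auto
      fix a :: "nat \<Rightarrow> real" and \<rho> :: real
      assume \<rho>: "0 \<le> \<rho>" "\<rho> \<le> 1" and a1: "a 1 = 0" and a0: "\<forall>q. 0 \<le> a q"
        and rec: "\<forall>q. 2 \<le> q \<longrightarrow> q \<le> p \<longrightarrow> a q \<le> D * \<rho> ^ (q - 1) + (\<Sum>m\<in>{1..<q}. a m * a (q - m))"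
      have am: "a m \<le> K m * \<rho> ^ ((m + 1) div 2)" if "m \<in> {1..<p}" for m
        using K[OF that] \<rho> a1 a0 rec that unfolding P_def by auto
      have "a p \<le> D * \<rho> ^ (p - 1) + (\<Sum>m\<in>{1..<p}. a m * a (p - m))" using rec p by simp
      also have "D * \<rho> ^ (p - 1) \<le> D * \<rho> ^ ((p + 1) div 2)"
        by (intro mult_left_mono power_decreasing D \<rho>) (use p in linarith)
      also have "(\<Sum>m\<in>{1..<p}. a m * a (p - m)) \<le> (\<Sum>m\<in>{1..<p}. K m * K (p - m) * \<rho> ^ ((p + 1) div 2))"
      proof (rule sum_mono)
        fix m assume m: "m \<in> {1..<p}"
        then have m': "p - m \<in> {1..<p}" by auto
        have "a m * a (p - m) \<le> (K m * \<rho> ^ ((m + 1) div 2)) * (K (p - m) * \<rho> ^ ((p - m + 1) div 2))"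
          by (intro mult_mono am m m' mult_nonneg_nonneg K0) (use a0 \<rho> in auto)
        also have "\<dots> = K m * K (p - m) * \<rho> ^ ((m + 1) div 2 + (p - m + 1) div 2)"
          by (simp add: power_add)
        also have "\<dots> \<le> K m * K (p - m) * \<rho> ^ ((p + 1) div 2)"
        proof (intro mult_left_mono power_decreasing \<rho> mult_nonneg_nonneg K0 m m')
          obtain k where "p = m + k" using m by (metis atLeastLessThan_iff le_add_diff_inverse less_imp_le)
          then show "(p + 1) div 2 \<le> (m + 1) div 2 + (p - m + 1) div 2" by simp
        qed
        finally show "a m * a (p - m) \<le> K m * K (p - m) * \<rho> ^ ((p + 1) div 2)" .
      qed
      finally show "a p \<le> (D + (\<Sum>m\<in>{1..<p}. K m * K (p - m))) * \<rho> ^ ((p + 1) div 2)"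
        by (simp add: distrib_right sum_distrib_right)
    qed
  qed
qed

section \<open>Weighted sums of the covariance bounds\<close>

lemma sum_shift_le:
  fixes h :: "nat \<Rightarrow> real"
  assumes h: "\<And>t. 0 \<le> h t" and k: "k \<le> b"
  shows "(\<Sum>r\<in>{..<N} - {..<b}. h (r - k)) \<le> (\<Sum>t<N. h t)"
proof -
  have "(\<Sum>r\<in>{..<N} - {..<b}. h (r - k)) = (\<Sum>t\<in>(\<lambda>r. r - k) ` ({..<N} - {..<b}). h t)"
    by (rule sum.reindex_cong[symmetric, OF _ refl refl]) (use k in \<open>auto simp: inj_on_def\<close>)
  also have "\<dots> \<le> (\<Sum>t<N. h t)" by (rule sum_mono2) (use h in auto)
  finally show ?thesis .
qed

text \<open>
  The first \<open>b\<close> gaps, for which blocks may overlap, contribute \<open>b * b ^ (q - 2)\<close>. Beyond them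
  \<open>r + 1 \<le> 2 * b * (t + 1)\<close> for \<open>r = t + b\<close>, which factors \<open>b ^ (q - 2)\<close> out of the weight and leaves the
  weight of the coefficient \<open>e t\<close>.
\<close>
lemma gap_sum_overlapping_le:
  fixes e :: "nat \<Rightarrow> real" and \<Lambda> W D :: real
  assumes b: "1 \<le> b" and q: "2 \<le> q" "q \<le> p" and \<Lambda>: "1 \<le> \<Lambda>" and W: "0 \<le> W" and e: "\<And>t. 0 \<le> e t"
    and D: "(\<Sum>t<N. real (t + 1) ^ (p - 2) * e t) \<le> D"
  shows "(\<Sum>r<N. real (r + 1) ^ (q - 2) * (if r < b then 2 else W * \<Lambda> * real b * e (r - b)))
    \<le> (2 + 2 ^ p * W * D) * (real b ^ (q - 1) * \<Lambda>)"
proof -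
  let ?f = "\<lambda>r. real (r + 1) ^ (q - 2) * (if r < b then 2 else W * \<Lambda> * real b * e (r - b))"
  have b_pow: "real b * real b ^ (q - 2) = real b ^ (q - 1)"
    using q by (metis Suc_diff_le diff_Suc_Suc numeral_2_eq_2 power_Suc One_nat_def)
  have "(\<Sum>r\<in>{..<N} \<inter> {..<b}. ?f r) \<le> (\<Sum>r\<in>{..<N} \<inter> {..<b}. 2 * real b ^ (q - 2))"
  proof (rule sum_mono)
    fix r assume "r \<in> {..<N} \<inter> {..<b}"
    then have "real (r + 1) ^ (q - 2) \<le> real b ^ (q - 2)" "r < b" by (auto intro!: power_mono)
    then show "?f r \<le> 2 * real b ^ (q - 2)" by simp
  qed
  also have "\<dots> \<le> real b * (2 * real b ^ (q - 2))"
    using card_mono[of "{..<b}" "{..<N} \<inter> {..<b}"] by (simp add: mult_right_mono)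
  also have "\<dots> = 2 * real b ^ (q - 1)" using b_pow by simp
  also have "\<dots> \<le> 2 * (real b ^ (q - 1) * \<Lambda>)" using \<Lambda> by (simp add: mult_le_cancel_left1)
  finally have short: "(\<Sum>r\<in>{..<N} \<inter> {..<b}. ?f r) \<le> 2 * (real b ^ (q - 1) * \<Lambda>)" .
  let ?h = "\<lambda>t. real (t + 1) ^ (p - 2) * e t"
  have "(\<Sum>r\<in>{..<N} - {..<b}. ?f r) \<le> (\<Sum>r\<in>{..<N} - {..<b}. 2 ^ p * W * \<Lambda> * real b ^ (q - 1) * ?h (r - b))"
  proof (rule sum_mono)
    fix r assume r: "r \<in> {..<N} - {..<b}"
    define t where "t = r - b"
    have rt: "r = t + b" using r by (simp add: t_def)
    have "r + 1 \<le> 2 * b * (t + 1)"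
    proof -
      have "t \<le> b * t" using mult_le_mono1[OF b, of t] by simp
      moreover have "2 * b * (t + 1) = 2 * (b * t) + 2 * b" by (simp add: algebra_simps)
      ultimately show ?thesis using b rt by linarith
    qed
    then have "real (r + 1) \<le> real (2 * b * (t + 1))" by (rule of_nat_mono)
    then have "real (r + 1) \<le> 2 * real b * real (t + 1)" by (simp only: of_nat_mult of_nat_numeral)
    then have "real (r + 1) ^ (q - 2) \<le> (2 * real b * real (t + 1)) ^ (q - 2)"
      by (intro power_mono) auto
    also have "\<dots> = 2 ^ (q - 2) * real b ^ (q - 2) * real (t + 1) ^ (q - 2)"
      by (simp add: power_mult_distrib)
    also have "\<dots> \<le> 2 ^ p * real b ^ (q - 2) * real (t + 1) ^ (p - 2)"
      by (intro mult_mono power_increasing) (use q b in auto)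
    finally have "?f r \<le> (2 ^ p * real b ^ (q - 2) * real (t + 1) ^ (p - 2)) * (W * \<Lambda> * real b * e t)"
      unfolding rt using W \<Lambda> e by (simp add: mult_right_mono)
    also have "\<dots> = 2 ^ p * W * \<Lambda> * (real b * real b ^ (q - 2)) * ?h t" by (simp only: mult_ac)
    finally show "?f r \<le> 2 ^ p * W * \<Lambda> * real b ^ (q - 1) * ?h (r - b)"
      unfolding b_pow t_def .
  qed
  also have "\<dots> \<le> (\<Sum>t<N. 2 ^ p * W * \<Lambda> * real b ^ (q - 1) * ?h t)"
    by (rule sum_shift_le) (use W \<Lambda> e in auto)
  also have "\<dots> \<le> 2 ^ p * W * \<Lambda> * real b ^ (q - 1) * D"
    unfolding sum_distrib_left[symmetric] by (rule mult_left_mono[OF D]) (use W \<Lambda> in auto)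
  finally have long: "(\<Sum>r\<in>{..<N} - {..<b}. ?f r) \<le> 2 ^ p * W * D * (real b ^ (q - 1) * \<Lambda>)"
    by (simp only: mult_ac)
  have "(\<Sum>r<N. ?f r) = (\<Sum>r\<in>{..<N} \<inter> {..<b}. ?f r) + (\<Sum>r\<in>{..<N} - {..<b}. ?f r)"
    by (rule sum.Int_Diff) simp
  then show ?thesis using short long by (simp only: distrib_right)
qed

text \<open>
  Here a gap of \<open>r\<close> blocks corresponds to a time lag of about \<open>r b\<close>, and the bound for it is a sum over
  the \<open>b\<close> lags \<open>j\<close> of one earlier block, so that the sum over \<open>r\<close> becomes a sum over all lags. For
  \<open>r \<ge> 3\<close> the block starts at lag \<open>(r - 2) * b \<ge> b\<close>. Hence \<open>r + 1 \<le> 4 * (j + 1) / b\<close>, and since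
  \<open>(j + 1) / b \<ge> 1\<close> the exponent \<open>q - 2\<close> can be raised to \<open>p - 2\<close>: the hypothesis for \<open>p\<close> suffices for
  all lower orders \<open>q\<close>.
\<close>
lemma gap_sum_nonoverlapping_le:
  fixes e :: "nat \<Rightarrow> real" and \<Lambda> W D :: real
  assumes b: "1 \<le> b" and q: "2 \<le> q" "q \<le> p" and \<Lambda>: "1 \<le> \<Lambda>" and W: "0 \<le> W" and e: "\<And>t. 0 \<le> e t"
    and D: "(\<Sum>t<n. real (t + 1) ^ (p - 2) * e t) \<le> D * real b ^ (p - 2)" and n: "N * b \<le> n"
  shows "(\<Sum>r<N. real (r + 1) ^ (q - 2) * (if r < 3 then 2 else W * \<Lambda> * (\<Sum>j\<in>{(r - 2) * b..<(r - 1) * b}. e j)))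
    \<le> (6 * 3 ^ p + 4 ^ p * W * D) * \<Lambda>"
proof -
  let ?f = "\<lambda>r. real (r + 1) ^ (q - 2) * (if r < 3 then 2 else W * \<Lambda> * (\<Sum>j\<in>{(r - 2) * b..<(r - 1) * b}. e j))"
  have "(\<Sum>r\<in>{..<N} \<inter> {..<3}. ?f r) \<le> (\<Sum>r\<in>{..<N} \<inter> {..<3}. 2 * 3 ^ p)"
  proof (rule sum_mono)
    fix r assume r: "r \<in> {..<N} \<inter> {..<3}"
    then have "real (r + 1) ^ (q - 2) \<le> 3 ^ (q - 2)" by (auto intro!: power_mono)
    also have "\<dots> \<le> 3 ^ p" using q by (intro power_increasing) auto
    finally show "?f r \<le> 2 * 3 ^ p" using r by simp
  qed
  also have "\<dots> \<le> 3 * (2 * 3 ^ p)"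
    using card_mono[of "{..<3}" "{..<N} \<inter> {..<3::nat}"] by (simp add: mult_right_mono)
  also have "\<dots> \<le> 6 * 3 ^ p * \<Lambda>" using \<Lambda> by simp
  finally have short: "(\<Sum>r\<in>{..<N} \<inter> {..<3}. ?f r) \<le> 6 * 3 ^ p * \<Lambda>" .
  define h where "h = (\<lambda>j. (real (j + 1) / real b) ^ (p - 2) * e j)"
  have h0: "0 \<le> h j" for j using e by (simp add: h_def)
  define H where "H = (\<lambda>k. sum h {k * b..<k * b + b})"
  have "(\<Sum>r\<in>{..<N} - {..<3}. ?f r) \<le> (\<Sum>r\<in>{..<N} - {..<3}. 4 ^ p * W * \<Lambda> * H (r - 2))"
  proof (rule sum_mono)
    fix r assume r: "r \<in> {..<N} - {..<3}"
    define k where "k = r - 2"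
    have rk: "r = k + 2" and k: "1 \<le> k" using r by (auto simp: k_def)
    have "real (r + 1) ^ (q - 2) * (\<Sum>j\<in>{k * b..<k * b + b}. e j) \<le> (\<Sum>j\<in>{k * b..<k * b + b}. 4 ^ p * h j)"
      unfolding sum_distrib_left
    proof (rule sum_mono)
      fix j assume "j \<in> {k * b..<k * b + b}"
      then have "real k * real b \<le> real j" by (simp flip: of_nat_mult)
      then have kj: "real k \<le> real (j + 1) / real b" using b by (simp add: pos_le_divide_eq)
      have "real (r + 1) \<le> 4 * real k" using k by (simp add: rk)
      also have "\<dots> \<le> 4 * (real (j + 1) / real b)" using kj by (rule mult_left_mono) simp
      finally have "real (r + 1) ^ (q - 2) \<le> (4 * (real (j + 1) / real b)) ^ (q - 2)"
        by (rule power_mono) simp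
      also have "\<dots> = 4 ^ (q - 2) * (real (j + 1) / real b) ^ (q - 2)" by (simp only: power_mult_distrib)
      also have "\<dots> \<le> 4 ^ p * (real (j + 1) / real b) ^ (p - 2)"
        by (intro mult_mono power_increasing) (use q k kj in auto)
      finally show "real (r + 1) ^ (q - 2) * e j \<le> 4 ^ p * h j"
        unfolding h_def mult.assoc[symmetric] by (rule mult_right_mono[OF _ e])
    qed
    then have "W * \<Lambda> * (real (r + 1) ^ (q - 2) * (\<Sum>j\<in>{k * b..<k * b + b}. e j)) \<le> W * \<Lambda> * (4 ^ p * H k)"
      unfolding H_def sum_distrib_left[symmetric] using W \<Lambda> by (intro mult_left_mono) auto
    moreover have "{(r - 2) * b..<(r - 1) * b} = {k * b..<k * b + b}" by (simp add: rk add.commute)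
    moreover have "\<not> r < 3" using r by simp
    ultimately show "?f r \<le> 4 ^ p * W * \<Lambda> * H (r - 2)"
      unfolding k_def[symmetric] by (simp add: mult_ac)
  qed
  also have "\<dots> \<le> (\<Sum>k<N. 4 ^ p * W * \<Lambda> * H k)"
    by (rule sum_shift_le) (use W \<Lambda> h0 in \<open>auto simp: H_def intro!: mult_nonneg_nonneg sum_nonneg\<close>)
  also have "\<dots> = 4 ^ p * W * \<Lambda> * (\<Sum>j<N * b. h j)"
    unfolding H_def sum_distrib_left[symmetric] by (simp only: sum.nat_group)
  also have "\<dots> \<le> 4 ^ p * W * \<Lambda> * D"
  proof (rule mult_left_mono)
    have "(\<Sum>j<N * b. h j) \<le> (\<Sum>j<n. h j)" by (rule sum_mono2) (use n h0 in auto)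
    also have "\<dots> = (\<Sum>t<n. real (t + 1) ^ (p - 2) * e t) / real b ^ (p - 2)"
      by (simp add: h_def power_divide sum_divide_distrib)
    also have "\<dots> \<le> D" using D b by (simp add: pos_divide_le_eq)
    finally show "(\<Sum>j<N * b. h j) \<le> D" .
  qed (use W \<Lambda> in auto)
  finally have long: "(\<Sum>r\<in>{..<N} - {..<3}. ?f r) \<le> 4 ^ p * W * D * \<Lambda>" by (simp only: mult_ac)
  have "(\<Sum>r<N. ?f r) = (\<Sum>r\<in>{..<N} \<inter> {..<3}. ?f r) + (\<Sum>r\<in>{..<N} - {..<3}. ?f r)"
    by (rule sum.Int_Diff) simp
  then show ?thesis using short long by (simp only: distrib_right)
qed

section \<open>Moments of means of weakly dependent variables\<close>

text \<open>
  The constant is chosen before the variables and the parameters \<open>N\<close>, \<open>\<tau>\<close>, \<open>\<Lambda>\<close>, \<open>\<rho>\<close>, since all of these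
  will vary with \<open>n\<close>. The hypothesis \<open>\<tau> * \<Lambda> \<le> c * \<rho> * N\<close> is the rate condition. Because
  \<open>\<Lambda> \<ge> 1\<close>, a single factor \<open>\<Lambda>\<close> is dominated by \<open>\<Lambda> ^ (q - 1)\<close>, so this condition may be raised to
  the power \<open>q - 1\<close>.
\<close>
lemma (in prob_space) ex_moment_constant:
  fixes E c :: real
  assumes p: "1 \<le> p" and E: "0 \<le> E" and c: "1 \<le> c"
  obtains K where "0 \<le> K"
    and "\<And>V N C \<tau> \<Lambda> \<rho>. \<lbrakk>\<And>i. V i \<in> borel_measurable M; \<And>i \<omega>. \<bar>V i \<omega>\<bar> \<le> 1; \<And>i. expectation (V i) = 0;
        1 \<le> N; \<And>r. 0 \<le> C r; 0 \<le> \<tau>; 1 \<le> \<Lambda>; 0 \<le> \<rho>; \<rho> \<le> 1; \<tau> * \<Lambda> \<le> c * \<rho> * real N;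
        \<And>q xs m. \<lbrakk>2 \<le> q; q \<le> p; xs \<in> sorted_tuples N q; 1 \<le> m; m < q\<rbrakk> \<Longrightarrow>
          \<bar>expectation (\<lambda>\<omega>. \<Prod>i\<leftarrow>xs. V i \<omega>)
            - expectation (\<lambda>\<omega>. \<Prod>i\<leftarrow>take m xs. V i \<omega>) * expectation (\<lambda>\<omega>. \<Prod>i\<leftarrow>drop m xs. V i \<omega>)\<bar>
          \<le> C (xs ! m - xs ! (m - 1));
        \<And>q. \<lbrakk>2 \<le> q; q \<le> p\<rbrakk> \<Longrightarrow> (\<Sum>r<N. real (r + 1) ^ (q - 2) * C r) \<le> E * (\<tau> ^ (q - 1) * \<Lambda>)\<rbrakk>
      \<Longrightarrow> \<bar>expectation (\<lambda>\<omega>. ((\<Sum>i<N. V i \<omega>) / real N) ^ p)\<bar> \<le> K * \<rho> ^ ((p + 1) div 2)"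
proof -
  \<comment> \<open>\<open>p\<close> and \<open>c ^ p\<close> bound \<open>q - 1\<close> and \<open>c ^ (q - 1)\<close> for all orders \<open>q \<le> p\<close>\<close>
  have "0 \<le> real p * E * c ^ p" using E c by simp
  then obtain K where K0: "0 \<le> K" and K: "\<And>a \<rho>. 0 \<le> \<rho> \<Longrightarrow> \<rho> \<le> 1 \<Longrightarrow> a 1 = 0 \<Longrightarrow> (\<And>q. 0 \<le> a q) \<Longrightarrow>
    (\<And>q. 2 \<le> q \<Longrightarrow> q \<le> p \<Longrightarrow> a q \<le> real p * E * c ^ p * \<rho> ^ (q - 1) + (\<Sum>m\<in>{1..<q}. a m * a (q - m))) \<Longrightarrow>
    a p \<le> K * \<rho> ^ ((p + 1) div 2)"
    using quadratic_recursion_bound[OF _ p, of "real p * E * c ^ p"] by auto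
  show thesis
  proof (rule that[of "fact p * K"])
    show "0 \<le> fact p * K" using K0 by simp
    fix V :: "nat \<Rightarrow> 'a \<Rightarrow> real" and N :: nat and C :: "nat \<Rightarrow> real" and \<tau> \<Lambda> \<rho> :: real
    assume V: "\<And>i. V i \<in> borel_measurable M" "\<And>i \<omega>. \<bar>V i \<omega>\<bar> \<le> 1" "\<And>i. expectation (V i) = 0"
      and N: "1 \<le> N" and C: "\<And>r. 0 \<le> C r" and \<tau>: "0 \<le> \<tau>" and \<Lambda>: "1 \<le> \<Lambda>" and \<rho>: "0 \<le> \<rho>" "\<rho> \<le> 1"
      and \<tau>\<Lambda>: "\<tau> * \<Lambda> \<le> c * \<rho> * real N"
      and split: "\<And>q xs m. \<lbrakk>2 \<le> q; q \<le> p; xs \<in> sorted_tuples N q; 1 \<le> m; m < q\<rbrakk> \<Longrightarrow>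
          \<bar>expectation (\<lambda>\<omega>. \<Prod>i\<leftarrow>xs. V i \<omega>)
            - expectation (\<lambda>\<omega>. \<Prod>i\<leftarrow>take m xs. V i \<omega>) * expectation (\<lambda>\<omega>. \<Prod>i\<leftarrow>drop m xs. V i \<omega>)\<bar>
          \<le> C (xs ! m - xs ! (m - 1))"
      and sumC: "\<And>q. \<lbrakk>2 \<le> q; q \<le> p\<rbrakk> \<Longrightarrow> (\<Sum>r<N. real (r + 1) ^ (q - 2) * C r) \<le> E * (\<tau> ^ (q - 1) * \<Lambda>)"
    define \<mu> where "\<mu> = (\<lambda>xs. expectation (\<lambda>\<omega>. \<Prod>i\<leftarrow>xs. V i \<omega>))"
    define A where "A = (\<lambda>q. \<Sum>xs\<in>sorted_tuples N q. \<bar>\<mu> xs\<bar>)"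
    define a where "a = (\<lambda>q. A q / real N ^ q)"
    have "a p \<le> K * \<rho> ^ ((p + 1) div 2)"
    proof (rule K[OF \<rho>])
      have "\<mu> xs = 0" if "xs \<in> sorted_tuples N 1" for xs
        using that V(3) by (auto simp: sorted_tuples_def length_Suc_conv \<mu>_def)
      then show "a 1 = 0" by (simp add: a_def A_def)
      show "0 \<le> a q" for q by (simp add: a_def A_def sum_nonneg)
      fix q assume q: "2 \<le> q" "q \<le> p"
      have "\<tau> ^ (q - 1) * \<Lambda> \<le> \<tau> ^ (q - 1) * \<Lambda> ^ (q - 1)"
        using q \<Lambda> \<tau> by (intro mult_left_mono self_le_power) auto
      also have "\<dots> = (\<tau> * \<Lambda>) ^ (q - 1)" by (simp add: power_mult_distrib)
      also have "\<dots> \<le> (c * \<rho> * real N) ^ (q - 1)"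
        using \<tau> \<Lambda> by (intro power_mono \<tau>\<Lambda>) auto
      also have "\<dots> = c ^ (q - 1) * \<rho> ^ (q - 1) * real N ^ (q - 1)" by (simp add: power_mult_distrib)
      also have "\<dots> \<le> c ^ p * \<rho> ^ (q - 1) * real N ^ (q - 1)"
        using q c \<rho> by (intro mult_right_mono power_increasing) auto
      finally have "E * (\<tau> ^ (q - 1) * \<Lambda>) \<le> E * (c ^ p * \<rho> ^ (q - 1) * real N ^ (q - 1))"
        using E by (rule mult_left_mono)
      then have sumC': "(\<Sum>r<N. real (r + 1) ^ (q - 2) * C r) \<le> E * (c ^ p * \<rho> ^ (q - 1) * real N ^ (q - 1))"
        using sumC[OF q] by simp
      have "A q \<le> (\<Sum>m\<in>{1..<q}. A m * A (q - m))
          + real (q - 1) * real N * (\<Sum>r<N. real (r + 1) ^ (q - 2) * C r)"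
        unfolding A_def using split[OF q] by (intro sum_sorted_tuples_max_gap_le q C) (auto simp: \<mu>_def)
      also have "real (q - 1) * real N * (\<Sum>r<N. real (r + 1) ^ (q - 2) * C r)
          \<le> real p * real N * (E * (c ^ p * \<rho> ^ (q - 1) * real N ^ (q - 1)))"
        using q C by (intro mult_mono sumC' sum_nonneg) auto
      also have "\<dots> = real p * E * c ^ p * \<rho> ^ (q - 1) * (real N * real N ^ (q - 1))" by (simp only: mult_ac)
      also have "real N * real N ^ (q - 1) = real N ^ q" using q by (simp flip: power_Suc)
      also have "(\<Sum>m\<in>{1..<q}. A m * A (q - m)) = (\<Sum>m\<in>{1..<q}. a m * a (q - m)) * real N ^ q"
        unfolding sum_distrib_right
      proof (rule sum.cong[OF refl])
        fix m assume "m \<in> {1..<q}"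
        then have "real N ^ q = real N ^ m * real N ^ (q - m)" by (simp flip: power_add)
        then show "A m * A (q - m) = a m * a (q - m) * real N ^ q" using N by (simp add: a_def)
      qed
      finally have "A q \<le> (real p * E * c ^ p * \<rho> ^ (q - 1) + (\<Sum>m\<in>{1..<q}. a m * a (q - m))) * real N ^ q"
        by (simp only: distrib_right add_ac)
      then show "a q \<le> real p * E * c ^ p * \<rho> ^ (q - 1) + (\<Sum>m\<in>{1..<q}. a m * a (q - m))"
        unfolding a_def using N by (simp add: pos_divide_le_eq)
    qed
    then have "fact p * a p \<le> fact p * (K * \<rho> ^ ((p + 1) div 2))" by (rule mult_left_mono) simp
    moreover have "\<bar>expectation (\<lambda>\<omega>. ((\<Sum>i<N. V i \<omega>) / real N) ^ p)\<bar> \<le> fact p * a p"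
      using divide_right_mono[OF abs_expectation_power_sum_le[of V N p, OF V(1,2)], of "real N ^ p"]
      by (simp add: power_divide a_def A_def \<mu>_def abs_divide)
    ultimately show "\<bar>expectation (\<lambda>\<omega>. ((\<Sum>i<N. V i \<omega>) / real N) ^ p)\<bar> \<le> fact p * K * \<rho> ^ ((p + 1) div 2)"
      unfolding mult.assoc by linarith
  qed
qed

section \<open>Block statistics\<close>

lemma phi_eq_max_min: "phi x = max 0 (min 1 (1 - x))"
  by (auto simp: phi_def)

lemma phi_nonneg: "0 \<le> phi x" and phi_le_1: "phi x \<le> 1"
  by (auto simp: phi_def)

lemma phi_antimono: "x \<le> y \<Longrightarrow> phi y \<le> phi x"
  by (auto simp: phi_def)

lemma phi_lipschitz: "\<bar>phi y - phi x\<bar> \<le> \<bar>y - x\<bar>"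
  by (auto simp: phi_def)

lemma phi_measurable [measurable]: "phi \<in> borel_measurable borel"
  unfolding phi_eq_max_min[abs_def] by measurable

lemma tuple_measurable [measurable (raw)]:
  assumes "\<And>t. X t \<in> borel_measurable M"
  shows "tuple X u c \<in> measurable M (Pi\<^sub>M {..<u} (\<lambda>_. borel))"
  unfolding tuple_def[abs_def] by (intro measurable_restrict assms)

lemma (in prob_space) Cov_eq_bounded:
  assumes "U \<in> borel_measurable M" "V \<in> borel_measurable M" "\<And>\<omega>. \<bar>U \<omega>\<bar> \<le> 1" "\<And>\<omega>. \<bar>V \<omega>\<bar> \<le> 1"
  shows "Cov M U V = expectation (\<lambda>\<omega>. U \<omega> * V \<omega>) - expectation U * expectation V"
proof -
  have U: "integrable M U" and V: "integrable M V"
    by (rule integrable_const_bound[of _ 1]; use assms in simp)+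
  have UV: "integrable M (\<lambda>\<omega>. U \<omega> * V \<omega>)"
    by (rule integrable_const_bound[of _ 1]) (use assms in \<open>auto simp: abs_mult intro!: mult_le_one\<close>)
  have "Cov M U V = expectation (\<lambda>\<omega>. U \<omega> * V \<omega> - expectation V * U \<omega> - expectation U * V \<omega> + expectation U * expectation V)"
    unfolding Cov_def by (rule Bochner_Integration.integral_cong) (auto simp: algebra_simps)
  also have "\<dots> = expectation (\<lambda>\<omega>. U \<omega> * V \<omega>) - expectation V * expectation U - expectation U * expectation V
      + expectation U * expectation V"
    using U V UV by (simp add: prob_space)
  finally show ?thesis by simp
qed

text \<open>
  Cutting a sorted tuple at position \<open>m\<close>: monotone block positions \<open>a\<close> make the gap between the two
  blocks adjacent to the cut the gap between the two groups of blocks. The condition on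
  \<open>\<kappa> * b * l\<^sup>2\<close> absorbs the mixed term of the coefficient, leaving one factor \<open>b\<close>.
\<close>
lemma (in prob_space) expectation_prod_blocks_split:
  fixes G :: "nat \<Rightarrow> (nat \<Rightarrow> real) \<Rightarrow> real" and a :: "nat \<Rightarrow> int"
  assumes e: "\<And>r. mixed_coeff \<kappa> M X r = ennreal (e r)" "\<And>r. 0 \<le> e r" and \<kappa>: "0 \<le> \<kappa>"
    and X: "\<And>t. X t \<in> borel_measurable M"
    and G: "\<And>i. lipschitz_tuples b l (G i)" "\<And>i x. \<bar>G i x\<bar> \<le> 1"
      "\<And>i. G i \<in> borel_measurable (Pi\<^sub>M {..<b} (\<lambda>_. borel))"
    and b: "1 \<le> b" and a: "mono a"
    and \<Lambda>: "l \<le> \<Lambda>" "\<kappa> * real b * l\<^sup>2 \<le> \<Lambda>"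
    and xs: "xs \<in> sorted_tuples N q" and m: "1 \<le> m" "m < q" "q \<le> p"
    and sep: "a (xs ! (m - 1)) + int b - 1 + int r \<le> a (xs ! m)"
  defines "\<mu> \<equiv> \<lambda>xs. expectation (\<lambda>\<omega>. \<Prod>i\<leftarrow>xs. G i (tuple X b (\<lambda>j. a i + int j) \<omega>))"
  shows "\<bar>\<mu> xs - \<mu> (take m xs) * \<mu> (drop m xs)\<bar> \<le> 4 * (real p)\<^sup>2 * \<Lambda> * real b * e r"
proof -
  define F where "F = (\<lambda>zs \<omega>. \<Prod>i\<leftarrow>zs. G i (tuple X b (\<lambda>j. a i + int j) \<omega>))"
  have l: "0 \<le> l" using G(1) by (auto simp: lipschitz_tuples_def)
  have meas_G: "(\<lambda>\<omega>. G i (tuple X b (\<lambda>j. a i + int j) \<omega>)) \<in> borel_measurable M" for i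
    by (rule measurable_compose[OF tuple_measurable G(3)]) (rule X)
  have F_meas: "F zs \<in> borel_measurable M" for zs
    unfolding F_def by (induction zs) (auto intro!: borel_measurable_times meas_G)
  have F1: "\<bar>F zs \<omega>\<bar> \<le> 1" for zs \<omega>
    unfolding F_def by (induction zs) (auto simp: abs_mult intro!: mult_le_one G)
  have len: "length xs = q" and srt: "sorted xs" using xs by (auto simp: sorted_tuples_def)
  have \<mu>_F: "\<mu> zs = expectation (F zs)" for zs by (simp add: \<mu>_def F_def)
  have "F (take m xs) \<omega> * F (drop m xs) \<omega> = F xs \<omega>" for \<omega>
    unfolding F_def by (simp flip: prod_list.append map_append)
  then have "\<mu> xs - \<mu> (take m xs) * \<mu> (drop m xs) = Cov M (F (take m xs)) (F (drop m xs))"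
    by (subst Cov_eq_bounded) (simp_all add: F_meas F1 \<mu>_F)
  also have "\<bar>\<dots>\<bar> \<le> 2 * e r * (real (length (take m xs) * b) * l + real (length (drop m xs) * b) * l
        + \<kappa> * (real (length (take m xs) * b) * l) * (real (length (drop m xs) * b) * l))"
    unfolding F_def
  proof (rule Cov_prod_blocks_le[OF e \<kappa> G(1,2) b])
    show "take m xs \<noteq> []" "drop m xs \<noteq> []" using m len by auto
    fix i j assume "i \<in> set (take m xs)" "j \<in> set (drop m xs)"
    then obtain i' j' where ij: "i = xs ! i'" "i' < m" "j = xs ! (m + j')" "m + j' < q"
      using len by (auto simp: in_set_conv_nth)
    have "i \<le> xs ! (m - 1)" "xs ! m \<le> j"
      unfolding ij using ij m len by (auto intro!: sorted_nth_mono[OF srt])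
    then have "a i \<le> a (xs ! (m - 1))" "a (xs ! m) \<le> a j" using a by (auto dest: monoD)
    then show "a i + int b - 1 + int r \<le> a j" using sep by linarith
  qed
  also have "\<dots> = 2 * e r * real b * (real q * l + real m * real (q - m) * (\<kappa> * real b * l\<^sup>2))"
    using m len by (simp add: power2_eq_square algebra_simps of_nat_diff)
  also have "\<dots> \<le> 2 * e r * real b * ((real p)\<^sup>2 * \<Lambda> + (real p)\<^sup>2 * \<Lambda>)"
  proof (intro mult_left_mono add_mono mult_mono \<Lambda>)
    have "real q \<le> real p * real p" using m
      by (intro order_trans[of "real q" "real p" "real p * real p"]) auto
    then show "real q \<le> (real p)\<^sup>2" by (simp add: power2_eq_square)
    have "real m * real (q - m) \<le> real p * real p" using m by (intro mult_mono) auto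
    then show "real m * real (q - m) \<le> (real p)\<^sup>2" by (simp add: power2_eq_square)
  qed (use l \<kappa> e(2) in auto)
  also have "\<dots> = 4 * (real p)\<^sup>2 * \<Lambda> * real b * e r" by simp
  finally show ?thesis .
qed

definition block_start :: "scheme \<Rightarrow> nat \<Rightarrow> nat \<Rightarrow> int" where
  "block_start sch b i = (case sch of Overlapping \<Rightarrow> int i + 1 | Nonoverlapping \<Rightarrow> (int i - 1) * int b + 1)"

lemma block_eq_tuple: "block sch X b i = tuple X b (\<lambda>j. block_start sch b i + int j)"
  by (cases sch) (auto simp: block_start_def algebra_simps)

lemma mono_block_start: "mono (block_start sch b)"
  by (rule monoI, cases sch) (auto simp: block_start_def mult_right_mono)

text \<open>
  The value \<open>2\<close> is the trivial bound for neighbouring blocks. In the non-overlapping scheme, the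
  average of the coefficients over the \<open>b\<close> lags of a block replaces the single coefficient at lag
  \<open>(r - 1) * b\<close>; its factor \<open>1 / b\<close> cancels the factor \<open>b\<close> of the covariance bound.
\<close>
definition gap_bound :: "scheme \<Rightarrow> nat \<Rightarrow> real \<Rightarrow> real \<Rightarrow> (nat \<Rightarrow> real) \<Rightarrow> nat \<Rightarrow> real" where
  "gap_bound sch b W \<Lambda> e r = (case sch of
     Overlapping \<Rightarrow> if r < b then 2 else W * \<Lambda> * real b * e (r - b)
   | Nonoverlapping \<Rightarrow> if r < 3 then 2 else W * \<Lambda> * (\<Sum>j\<in>{(r - 2) * b..<(r - 1) * b}. e j))"

lemma (in prob_space) expectation_prod_blocks_gap_bound:
  fixes G :: "nat \<Rightarrow> (nat \<Rightarrow> real) \<Rightarrow> real" and sch :: scheme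
  assumes e: "\<And>r. mixed_coeff \<kappa> M X r = ennreal (e r)" "\<And>r. 0 \<le> e r" and \<kappa>: "0 \<le> \<kappa>"
    and X: "\<And>t. X t \<in> borel_measurable M"
    and G: "\<And>i. lipschitz_tuples b l (G i)" "\<And>i x. \<bar>G i x\<bar> \<le> 1"
      "\<And>i. G i \<in> borel_measurable (Pi\<^sub>M {..<b} (\<lambda>_. borel))"
    and b: "1 \<le> b" and \<Lambda>: "l \<le> \<Lambda>" "\<kappa> * real b * l\<^sup>2 \<le> \<Lambda>"
    and xs: "xs \<in> sorted_tuples N q" and m: "1 \<le> m" "m < q" "q \<le> p"
  defines "\<mu> \<equiv> \<lambda>xs. expectation (\<lambda>\<omega>. \<Prod>i\<leftarrow>xs. G i (block sch X b i \<omega>))"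
  shows "\<bar>\<mu> xs - \<mu> (take m xs) * \<mu> (drop m xs)\<bar>
    \<le> gap_bound sch b (4 * (real p)\<^sup>2) \<Lambda> e (xs ! m - xs ! (m - 1))"
proof -
  let ?d = "\<bar>\<mu> xs - \<mu> (take m xs) * \<mu> (drop m xs)\<bar>" and ?a = "block_start sch b"
  define r where "r = xs ! m - xs ! (m - 1)"
  have "xs ! (m - 1) \<le> xs ! m"
    by (rule sorted_nth_mono) (use xs m in \<open>auto simp: sorted_tuples_def\<close>)
  then have gap: "xs ! m = xs ! (m - 1) + r" by (simp add: r_def)
  have far: "?d \<le> 4 * (real p)\<^sup>2 * \<Lambda> * real b * e k" if "?a (xs ! (m - 1)) + int b - 1 + int k \<le> ?a (xs ! m)" for k
    unfolding \<mu>_def block_eq_tuple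
    by (rule expectation_prod_blocks_split[OF e \<kappa> X G b mono_block_start \<Lambda> xs m that])
  have \<mu>1: "\<bar>\<mu> zs\<bar> \<le> 1" for zs
  proof -
    have "\<bar>\<Prod>i\<leftarrow>zs. G i (block sch X b i \<omega>)\<bar> \<le> 1" for \<omega>
      by (induction zs) (auto simp: abs_mult intro!: mult_le_one G)
    then have "expectation (\<lambda>\<omega>. \<bar>\<Prod>i\<leftarrow>zs. G i (block sch X b i \<omega>)\<bar>) \<le> expectation (\<lambda>\<omega>. 1)"
      by (intro Bochner_Integration.integral_mono') auto
    then show ?thesis unfolding \<mu>_def
      by (intro order_trans[OF integral_abs_bound]) (simp add: prob_space)
  qed
  have near: "?d \<le> 2"
  proof -
    have "\<bar>\<mu> (take m xs) * \<mu> (drop m xs)\<bar> \<le> 1"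
      unfolding abs_mult by (intro mult_le_one \<mu>1) simp
    then show ?thesis using \<mu>1[of xs] by linarith
  qed
  have "?d \<le> gap_bound sch b (4 * (real p)\<^sup>2) \<Lambda> e r"
  proof (cases sch)
    case Overlapping
    show ?thesis
    proof (cases "r < b")
      case True
      then show ?thesis using near Overlapping by (simp add: gap_bound_def)
    next
      case False
      then have "?d \<le> 4 * (real p)\<^sup>2 * \<Lambda> * real b * e (r - b)"
        by (intro far) (simp add: Overlapping block_start_def gap of_nat_diff)
      then show ?thesis using False Overlapping by (simp add: gap_bound_def)
    qed
  next
    case Nonoverlapping
    show ?thesis
    proof (cases "r < 3")
      case True
      then show ?thesis using near Nonoverlapping by (simp add: gap_bound_def)
    next
      case False
      let ?J = "{(r - 2) * b..<(r - 1) * b}"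
      have "(r - 1) * b = (r - 2) * b + b"
      proof -
        obtain k where "r = 3 + k" using False le_Suc_ex by (metis linorder_not_less)
        then show ?thesis by simp
      qed
      then have card: "card ?J = b" by simp
      have "?d \<le> 4 * (real p)\<^sup>2 * \<Lambda> * real b * e j" if "j \<in> ?J" for j
      proof (rule far)
        have "int j \<le> int ((r - 1) * b)" by (intro of_nat_mono) (use that in simp)
        also have "\<dots> = (int r - 1) * int b" using False by (simp add: of_nat_diff)
        finally have "int j \<le> (int r - 1) * int b" .
        then show "?a (xs ! (m - 1)) + int b - 1 + int j \<le> ?a (xs ! m)"
          by (simp add: Nonoverlapping block_start_def gap algebra_simps)
      qed
      \<comment> \<open>averaging the bounds for all lags of the block\<close>
      then have "(\<Sum>j\<in>?J. ?d) \<le> (\<Sum>j\<in>?J. 4 * (real p)\<^sup>2 * \<Lambda> * real b * e j)" by (rule sum_mono)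
      also have "\<dots> = real b * (4 * (real p)\<^sup>2 * \<Lambda> * (\<Sum>j\<in>?J. e j))"
        by (simp add: sum_distrib_left mult_ac)
      finally have "real b * ?d \<le> real b * (4 * (real p)\<^sup>2 * \<Lambda> * (\<Sum>j\<in>?J. e j))" 
        using card by simp
      then have "?d \<le> 4 * (real p)\<^sup>2 * \<Lambda> * (\<Sum>j\<in>?J. e j)" using b by simp
      then show ?thesis using False Nonoverlapping by (simp add: gap_bound_def)
    qed
  qed
  then show ?thesis by (simp only: r_def)
qed

section \<open>Moment bound for the smooth subsampling estimator\<close>

lemma num_blocks_bounds:
  assumes b: "1 \<le> b" and n: "2 * b \<le> n"
  shows "1 \<le> num_blocks sch b n"
    and "sch = Overlapping \<Longrightarrow> n \<le> 2 * num_blocks sch b n"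
    and "sch = Nonoverlapping \<Longrightarrow> n \<le> 2 * (b * num_blocks sch b n) \<and> num_blocks sch b n * b \<le> n"
proof -
  have div: "1 \<le> n div b" using b n div_le_mono[of b n b] by simp
  show "1 \<le> num_blocks sch b n" using b n div by (cases sch) auto
  show "n \<le> 2 * num_blocks sch b n" if "sch = Overlapping" using n that by simp
  show "n \<le> 2 * (b * num_blocks sch b n) \<and> num_blocks sch b n * b \<le> n" if "sch = Nonoverlapping"
  proof -
    have "n = b * (n div b) + n mod b" by simp
    moreover have "n mod b < b" using b by simp
    moreover have "b \<le> b * (n div b)" using div b by simp
    ultimately have "n \<le> 2 * (b * (n div b))" by linarith
    then show ?thesis using that by simp
  qed
qed

lemma lipschitz_tuples_phi:
  assumes s: "lipschitz_tuples u A s" and \<epsilon>: "0 < \<epsilon>"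
  shows "lipschitz_tuples u (A / \<epsilon>) (\<lambda>y. phi ((s y - x) / \<epsilon>) - c)"
  unfolding lipschitz_tuples_def
proof (intro conjI ballI)
  show "0 \<le> A / \<epsilon>" using s \<epsilon> by (simp add: lipschitz_tuples_def)
  fix y z :: "nat \<Rightarrow> real" assume y: "y \<in> {..<u} \<rightarrow>\<^sub>E UNIV" and z: "z \<in> {..<u} \<rightarrow>\<^sub>E UNIV"
  have "\<bar>phi ((s z - x) / \<epsilon>) - c - (phi ((s y - x) / \<epsilon>) - c)\<bar> \<le> \<bar>(s z - x) / \<epsilon> - (s y - x) / \<epsilon>\<bar>"
    using phi_lipschitz by simp
  also have "\<dots> = \<bar>s z - s y\<bar> / \<epsilon>" using \<epsilon> by (simp flip: diff_divide_distrib)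
  also have "\<dots> \<le> A * (\<Sum>i<u. \<bar>z i - y i\<bar>) / \<epsilon>"
    using s y z \<epsilon> by (intro divide_right_mono) (auto simp: lipschitz_tuples_def)
  finally show "\<bar>phi ((s z - x) / \<epsilon>) - c - (phi ((s y - x) / \<epsilon>) - c)\<bar> \<le> A / \<epsilon> * (\<Sum>i<u. \<bar>z i - y i\<bar>)"
    by simp
qed

lemma smooth_subsampling_bounds: "0 \<le> smooth_subsampling sch X s b \<epsilon> n x \<omega>" "smooth_subsampling sch X s b \<epsilon> n x \<omega> \<le> 1"
proof -
  let ?N = "num_blocks sch b n" and ?f = "\<lambda>i. phi ((s b (block sch X b i \<omega>) - x) / \<epsilon>)"
  show "0 \<le> smooth_subsampling sch X s b \<epsilon> n x \<omega>"
    unfolding smooth_subsampling_def by (intro divide_nonneg_nonneg sum_nonneg phi_nonneg) simp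
  have "(\<Sum>i<?N. ?f i) \<le> real ?N"
    using sum_mono[of "{..<?N}" ?f "\<lambda>_. 1"] phi_le_1 by simp
  then show "smooth_subsampling sch X s b \<epsilon> n x \<omega> \<le> 1"
    unfolding smooth_subsampling_def by (cases "?N = 0") (auto simp: divide_le_eq)
qed

lemma phi_block_measurable:
  assumes "\<And>t. X t \<in> borel_measurable M" and "s b \<in> borel_measurable (Pi\<^sub>M {..<b} (\<lambda>_. borel))"
  shows "(\<lambda>\<omega>. phi ((s b (block sch X b i \<omega>) - x) / \<epsilon>)) \<in> borel_measurable M"
proof -
  have [measurable]: "block sch X b i \<in> measurable M (Pi\<^sub>M {..<b} (\<lambda>_. borel))"
    unfolding block_eq_tuple by (rule tuple_measurable) (rule assms)
  note assms(2)[measurable]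
  show ?thesis by measurable
qed

lemma smooth_subsampling_measurable:
  assumes "\<And>t. X t \<in> borel_measurable M" and "s b \<in> borel_measurable (Pi\<^sub>M {..<b} (\<lambda>_. borel))"
  shows "smooth_subsampling sch X s b \<epsilon> n x \<in> borel_measurable M"
  unfolding smooth_subsampling_def[abs_def]
  by (intro borel_measurable_divide borel_measurable_sum phi_block_measurable assms) simp

lemma (in prob_space) abs_central_moment_le_1:
  assumes U: "U \<in> borel_measurable M" "\<And>\<omega>. 0 \<le> U \<omega>" "\<And>\<omega>. U \<omega> \<le> 1"
  shows "abs_central_moment M p U \<le> 1"
proof -
  have int: "integrable M U" by (rule integrable_const_bound[of _ 1]) (use U in auto)
  have "0 \<le> expectation U" using U by (intro Bochner_Integration.integral_nonneg) auto
  moreover have "expectation U \<le> expectation (\<lambda>_. 1)" using U int by (intro integral_mono) auto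
  ultimately have bound: "\<bar>U \<omega> - expectation U\<bar> \<le> 1" for \<omega>
    using U(2,3)[of \<omega>] by (simp add: prob_space abs_le_iff)
  have "abs_central_moment M p U \<le> expectation (\<lambda>\<omega>. \<bar>(U \<omega> - expectation U) ^ p\<bar>)"
    unfolding abs_central_moment_def by (rule integral_abs_bound)
  also have "\<dots> \<le> expectation (\<lambda>\<omega>. 1)"
    by (rule Bochner_Integration.integral_mono') (auto simp: power_abs intro!: power_le_one bound)
  finally show ?thesis by (simp add: prob_space)
qed

text \<open>
  The constant is uniform in \<open>x\<close> because \<open>x\<close> influences neither the Lipschitz constant nor the bound
  of the block values. Once \<open>n \<ge> 2 * b n\<close>, the number of blocks is at least \<open>n / 2\<close> or \<open>n / (2 * b n)\<close>,
  and the general moment bound applies; the finitely many smaller \<open>n\<close> are covered by the trivial bound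
  \<open>1\<close>.
\<close>
lemma (in prob_space) smooth_subsampling_moment_bound:
  fixes X :: "int \<Rightarrow> 'a \<Rightarrow> real" and s :: "nat \<Rightarrow> (nat \<Rightarrow> real) \<Rightarrow> real" and b :: "nat \<Rightarrow> nat"
    and \<epsilon> l \<Lambda> e :: "nat \<Rightarrow> real" and \<kappa> c D \<delta> :: real
  assumes X: "\<And>t. X t \<in> borel_measurable M"
    and s: "\<And>n. n \<ge> 1 \<Longrightarrow> s n \<in> borel_measurable (Pi\<^sub>M {..<n} (\<lambda>_. borel))"
    and b: "\<And>n. n \<ge> 1 \<Longrightarrow> b n \<ge> 1"
    and nb: "filterlim (\<lambda>n. real n / real (b n)) at_top sequentially"
    and \<epsilon>: "\<And>n. n \<ge> 1 \<Longrightarrow> \<epsilon> n > 0"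
    and p: "2 \<le> p"
    and e: "\<And>r. mixed_coeff \<kappa> M X r = ennreal (e r)" "\<And>r. 0 \<le> e r" and \<kappa>: "0 \<le> \<kappa>"
    and l: "\<And>n. n \<ge> 1 \<Longrightarrow> lipschitz_tuples (b n) (l n) (s (b n))"
    and \<Lambda>: "\<And>n. n \<ge> 1 \<Longrightarrow> 1 \<le> \<Lambda> n" "\<And>n. n \<ge> 1 \<Longrightarrow> l n / \<epsilon> n \<le> \<Lambda> n"
      "\<And>n. n \<ge> 1 \<Longrightarrow> \<kappa> * real (b n) * (l n / \<epsilon> n)\<^sup>2 \<le> \<Lambda> n"
    and rate: "\<And>n. n \<ge> 1 \<Longrightarrow> real (b n) / real n * \<Lambda> n \<le> c * real n powr (- \<delta>)"
    and \<delta>: "0 < \<delta>" and D: "0 \<le> D"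
    and sum_e: "\<And>n. n \<ge> 1 \<Longrightarrow> (\<Sum>t<n. real (t + 1) ^ (p - 2) * e t)
      \<le> D * (case sch of Overlapping \<Rightarrow> 1 | Nonoverlapping \<Rightarrow> real (b n) ^ (p - 2))"
  shows "\<exists>K\<ge>0. \<forall>n\<ge>1. \<forall>x. abs_central_moment M p (smooth_subsampling sch X s (b n) (\<epsilon> n) n x)
    \<le> K * real n powr (- (real ((p + 1) div 2) * \<delta>))"
proof -
  define W where "W = 4 * (real p)\<^sup>2"
  \<comment> \<open>large enough for the gap sums of both schemes\<close>
  define E where "E = 6 * 3 ^ p + 4 ^ p * W * D"
  define k where "k = (p + 1) div 2"
  have W: "0 \<le> W" by (simp add: W_def)
  have E: "0 \<le> E" using W D by (simp add: E_def)
  \<comment> \<open>the factor 2 is lost in passing from \<open>n\<close> to the number of blocks\<close>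
  have c': "1 \<le> 2 * max 1 c" by simp
  have p1: "1 \<le> p" using p by simp
  obtain K where K0: "0 \<le> K"
    and K: "\<And>V N C \<tau> \<Lambda> \<rho>. \<lbrakk>\<And>i. V i \<in> borel_measurable M; \<And>i \<omega>. \<bar>V i \<omega>\<bar> \<le> 1; \<And>i. expectation (V i) = 0;
        1 \<le> N; \<And>r. 0 \<le> C r; 0 \<le> \<tau>; 1 \<le> \<Lambda>; 0 \<le> \<rho>; \<rho> \<le> 1; \<tau> * \<Lambda> \<le> (2 * max 1 c) * \<rho> * real N;
        \<And>q xs m. \<lbrakk>2 \<le> q; q \<le> p; xs \<in> sorted_tuples N q; 1 \<le> m; m < q\<rbrakk> \<Longrightarrow>
          \<bar>expectation (\<lambda>\<omega>. \<Prod>i\<leftarrow>xs. V i \<omega>)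
            - expectation (\<lambda>\<omega>. \<Prod>i\<leftarrow>take m xs. V i \<omega>) * expectation (\<lambda>\<omega>. \<Prod>i\<leftarrow>drop m xs. V i \<omega>)\<bar>
          \<le> C (xs ! m - xs ! (m - 1));
        \<And>q. \<lbrakk>2 \<le> q; q \<le> p\<rbrakk> \<Longrightarrow> (\<Sum>r<N. real (r + 1) ^ (q - 2) * C r) \<le> E * (\<tau> ^ (q - 1) * \<Lambda>)\<rbrakk>
      \<Longrightarrow> \<bar>expectation (\<lambda>\<omega>. ((\<Sum>i<N. V i \<omega>) / real N) ^ p)\<bar> \<le> K * \<rho> ^ ((p + 1) div 2)"
    using ex_moment_constant[OF p1 E c'] by blast
  have "eventually (\<lambda>n. 2 \<le> real n / real (b n)) sequentially"
    using nb by (simp add: filterlim_at_top)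
  then obtain n0 where n0: "\<And>n. n \<ge> n0 \<Longrightarrow> 2 \<le> real n / real (b n)"
    by (auto simp: eventually_sequentially)
  have large: "abs_central_moment M p (smooth_subsampling sch X s (b n) (\<epsilon> n) n x)
      \<le> K * real n powr (- (real k * \<delta>))" if n: "n \<ge> 1" "n \<ge> n0" for n x
  proof -
    define B N where "B = b n" and "N = num_blocks sch B n"
    define \<rho> where "\<rho> = real n powr (- \<delta>)"
    define Z where "Z = (\<lambda>i \<omega>. phi ((s B (block sch X B i \<omega>) - x) / \<epsilon> n))"
    define G where "G = (\<lambda>i y. phi ((s B y - x) / \<epsilon> n) - expectation (Z i))"
    define V where "V = (\<lambda>i \<omega>. G i (block sch X B i \<omega>))"
    \<comment> \<open>chosen so that \<open>real B / real n\<close> and \<open>\<tau> / real N\<close> are comparable in either scheme\<close>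
    define \<tau> :: real where "\<tau> = (case sch of Overlapping \<Rightarrow> real B | Nonoverlapping \<Rightarrow> 1)"
    have B: "1 \<le> B" using b n by (simp add: B_def)
    have "2 * real B \<le> real n" using n0[OF n(2)] B by (simp add: B_def pos_le_divide_eq)
    then have n2B: "2 * B \<le> n" by linarith
    note N = num_blocks_bounds[OF B n2B, of sch, folded N_def]
    have sB: "s B \<in> borel_measurable (Pi\<^sub>M {..<B} (\<lambda>_. borel))" using s B by simp
    have Z_meas: "Z i \<in> borel_measurable M" for i
      unfolding Z_def by (intro phi_block_measurable X sB)
    have Z_int: "integrable M (Z i)" for i
      by (rule integrable_const_bound[of _ 1]) (use Z_meas phi_nonneg phi_le_1 in \<open>auto simp: Z_def\<close>)
    have EZ: "0 \<le> expectation (Z i)" "expectation (Z i) \<le> 1" for i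
    proof -
      show "0 \<le> expectation (Z i)"
        by (rule Bochner_Integration.integral_nonneg) (simp add: Z_def phi_nonneg)
      have "expectation (Z i) \<le> expectation (\<lambda>_. 1)"
        by (rule integral_mono[OF Z_int]) (simp_all add: Z_def phi_le_1)
      then show "expectation (Z i) \<le> 1" by (simp add: prob_space)
    qed
    have V_eq: "V i \<omega> = Z i \<omega> - expectation (Z i)" for i \<omega> by (simp add: V_def G_def Z_def)
    have G1: "\<bar>G i y\<bar> \<le> 1" for i y
      using EZ[of i] phi_nonneg[of "(s B y - x) / \<epsilon> n"] phi_le_1[of "(s B y - x) / \<epsilon> n"]
      by (simp add: G_def abs_le_iff)
    have G_lip: "lipschitz_tuples B (l n / \<epsilon> n) (G i)" for i
      unfolding G_def using l[OF n(1)] \<epsilon>[OF n(1)] by (intro lipschitz_tuples_phi) (simp_all add: B_def)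
    have G_meas: "G i \<in> borel_measurable (Pi\<^sub>M {..<B} (\<lambda>_. borel))" for i
      unfolding G_def using sB by measurable
    have \<rho>: "0 \<le> \<rho>" "\<rho> \<le> 1"
      using n \<delta> powr_mono[of "- \<delta>" 0 "real n"] by (auto simp: \<rho>_def)
    have \<Lambda>n: "1 \<le> \<Lambda> n" using \<Lambda>(1) n by simp
    have B\<Lambda>: "real B * \<Lambda> n \<le> max 1 c * \<rho> * real n"
    proof -
      have "real B * \<Lambda> n \<le> c * \<rho> * real n"
        using rate[OF n(1)] n(1) by (simp add: B_def \<rho>_def field_simps)
      also have "\<dots> \<le> max 1 c * \<rho> * real n" using \<rho> by (intro mult_right_mono) auto
      finally show ?thesis .
    qed
    have rate': "\<tau> * \<Lambda> n \<le> 2 * max 1 c * \<rho> * real N"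
    proof (cases sch)
      case Overlapping
      have "real n \<le> real (2 * N)" using N(2)[OF Overlapping] by (rule of_nat_mono)
      then have "max 1 c * \<rho> * real n \<le> max 1 c * \<rho> * (2 * real N)"
        using \<rho> by (intro mult_left_mono) auto
      then show ?thesis using B\<Lambda> Overlapping by (simp add: \<tau>_def mult_ac)
    next
      case Nonoverlapping
      have "real n \<le> real (2 * (B * N))" using N(3)[OF Nonoverlapping] by (intro of_nat_mono) simp
      then have "max 1 c * \<rho> * real n \<le> max 1 c * \<rho> * (2 * (real B * real N))"
        using \<rho> by (intro mult_left_mono) auto
      then have "real B * \<Lambda> n \<le> real B * (2 * max 1 c * \<rho> * real N)" using B\<Lambda> by (simp add: mult_ac)
      then show ?thesis using B Nonoverlapping by (simp add: \<tau>_def)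
    qed
    have "\<bar>expectation (\<lambda>\<omega>. ((\<Sum>i<N. V i \<omega>) / real N) ^ p)\<bar> \<le> K * \<rho> ^ ((p + 1) div 2)"
    proof (rule K[of V N "gap_bound sch B W (\<Lambda> n) e" \<tau> "\<Lambda> n" \<rho>])
      show "V i \<in> borel_measurable M" for i unfolding V_eq[abs_def] using Z_meas by measurable
      show "\<bar>V i \<omega>\<bar> \<le> 1" for i \<omega> unfolding V_def by (rule G1)
      show "expectation (V i) = 0" for i unfolding V_eq[abs_def] using Z_int by (simp add: prob_space)
      show "1 \<le> N" by (rule N(1))
      show "0 \<le> gap_bound sch B W (\<Lambda> n) e r" for r
        using W \<Lambda>n e(2) by (cases sch) (auto simp: gap_bound_def intro!: mult_nonneg_nonneg sum_nonneg)
      show "0 \<le> \<tau>" by (cases sch) (simp_all add: \<tau>_def)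
      show "1 \<le> \<Lambda> n" by (rule \<Lambda>n)
      show "0 \<le> \<rho>" "\<rho> \<le> 1" by (rule \<rho>)+
      show "\<tau> * \<Lambda> n \<le> 2 * max 1 c * \<rho> * real N" by (rule rate')
    next
      fix q xs m assume q: "2 \<le> q" "q \<le> p" and xs: "xs \<in> sorted_tuples N q" and m: "1 \<le> m" "m < q"
      show "\<bar>expectation (\<lambda>\<omega>. \<Prod>i\<leftarrow>xs. V i \<omega>)
            - expectation (\<lambda>\<omega>. \<Prod>i\<leftarrow>take m xs. V i \<omega>) * expectation (\<lambda>\<omega>. \<Prod>i\<leftarrow>drop m xs. V i \<omega>)\<bar>
          \<le> gap_bound sch B W (\<Lambda> n) e (xs ! m - xs ! (m - 1))"
        unfolding V_def W_def
        by (rule expectation_prod_blocks_gap_bound[OF e \<kappa> X G_lip G1 G_meas B _ _ xs m q(2)])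
          (use \<Lambda>(2,3)[OF n(1)] in \<open>simp_all add: B_def\<close>)
    next
      fix q assume q: "2 \<le> q" "q \<le> p"
      show "(\<Sum>r<N. real (r + 1) ^ (q - 2) * gap_bound sch B W (\<Lambda> n) e r) \<le> E * (\<tau> ^ (q - 1) * \<Lambda> n)"
      proof (cases sch)
        case Overlapping
        have "(\<Sum>t<N. real (t + 1) ^ (p - 2) * e t) \<le> D" using sum_e[of N] N(1) Overlapping by simp
        from gap_sum_overlapping_le[OF B q \<Lambda>n W e(2) this]
        have "(\<Sum>r<N. real (r + 1) ^ (q - 2) * gap_bound sch B W (\<Lambda> n) e r)
            \<le> (2 + 2 ^ p * W * D) * (\<tau> ^ (q - 1) * \<Lambda> n)"
          by (simp add: gap_bound_def Overlapping \<tau>_def)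
        also have "\<dots> \<le> E * (\<tau> ^ (q - 1) * \<Lambda> n)"
        proof (rule mult_right_mono)
          have "2 ^ p * W * D \<le> 4 ^ p * W * D" using W D by (intro mult_right_mono power_mono) auto
          moreover have "1 \<le> (3::real) ^ p" by simp
          ultimately show "2 + 2 ^ p * W * D \<le> E" unfolding E_def by linarith
          show "0 \<le> \<tau> ^ (q - 1) * \<Lambda> n" using \<Lambda>n by (simp add: \<tau>_def Overlapping)
        qed
        finally show ?thesis .
      next
        case Nonoverlapping
        have "(\<Sum>t<n. real (t + 1) ^ (p - 2) * e t) \<le> D * real B ^ (p - 2)"
          using sum_e[OF n(1)] Nonoverlapping by (simp add: B_def)
        from gap_sum_nonoverlapping_le[OF B q \<Lambda>n W e(2) this, of N] N(3)[OF Nonoverlapping]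
        show ?thesis by (simp add: gap_bound_def Nonoverlapping \<tau>_def E_def)
      qed
    qed
    moreover have "(\<Sum>i<N. V i \<omega>) / real N = smooth_subsampling sch X s B (\<epsilon> n) n x \<omega>
        - expectation (smooth_subsampling sch X s B (\<epsilon> n) n x)" for \<omega>
    proof -
      have "smooth_subsampling sch X s B (\<epsilon> n) n x = (\<lambda>\<omega>. (\<Sum>i<N. Z i \<omega>) / real N)"
        by (simp add: smooth_subsampling_def[abs_def] Z_def N_def)
      then show ?thesis using Z_int by (simp add: V_eq sum_subtractf diff_divide_distrib)
    qed
    moreover have "\<rho> ^ ((p + 1) div 2) = real n powr (- (real k * \<delta>))"
    proof -
      have "\<rho> ^ k = \<rho> powr real k" using n(1) by (simp add: \<rho>_def powr_realpow)
      also have "\<dots> = real n powr (- (real k * \<delta>))" by (simp add: \<rho>_def powr_powr mult.commute)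
      finally show ?thesis unfolding k_def .
    qed
    ultimately show ?thesis by (simp add: abs_central_moment_def B_def)
  qed
  show ?thesis
  proof (intro exI[of _ "K + real n0 powr (real k * \<delta>)"] conjI allI impI)
    show "0 \<le> K + real n0 powr (real k * \<delta>)" using K0 by simp
    fix n x assume n: "1 \<le> (n::nat)"
    show "abs_central_moment M p (smooth_subsampling sch X s (b n) (\<epsilon> n) n x)
      \<le> (K + real n0 powr (real k * \<delta>)) * real n powr (- (real ((p + 1) div 2) * \<delta>))"
    proof (cases "n \<ge> n0")
      case True
      have "K * real n powr (- (real k * \<delta>)) \<le> (K + real n0 powr (real k * \<delta>)) * real n powr (- (real k * \<delta>))"
        by (rule mult_right_mono) auto
      then show ?thesis using large[OF n True] unfolding k_def by (rule order_trans[rotated])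
    next
      case False
      have "abs_central_moment M p (smooth_subsampling sch X s (b n) (\<epsilon> n) n x) \<le> 1"
        using b[OF n]
        by (intro abs_central_moment_le_1 smooth_subsampling_measurable X s smooth_subsampling_bounds)
      also have "1 = real n powr (real k * \<delta>) * real n powr (- (real k * \<delta>))"
        using n by (simp flip: powr_add)
      also have "\<dots> \<le> (K + real n0 powr (real k * \<delta>)) * real n powr (- (real k * \<delta>))"
      proof (rule mult_right_mono)
        have "real n powr (real k * \<delta>) \<le> real n0 powr (real k * \<delta>)"
          using False \<delta> by (intro powr_mono2) auto
        then show "real n powr (real k * \<delta>) \<le> K + real n0 powr (real k * \<delta>)" using K0 by simp
      qed simp
      finally show ?thesis unfolding k_def .
    qed
  qed
qed

section \<open>Almost sure uniform convergence\<close>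

text \<open>
  The quantiles \<open>z q\<close> of level \<open>q = j / m\<close> cut the line into pieces on which \<open>K\<close> increases by at most
  \<open>1 / m\<close>. Monotonicity transfers closeness at these finitely many points to all \<open>x\<close>; near the two ends
  the bounds \<open>0\<close> and \<open>1\<close> take over.
\<close>
lemma polya_uniform_convergence:
  fixes F :: "nat \<Rightarrow> real \<Rightarrow> real" and K z :: "real \<Rightarrow> real"
  assumes F: "\<And>n. n \<ge> 1 \<Longrightarrow> mono (F n)" "\<And>n x. 0 \<le> F n x" "\<And>n x. F n x \<le> 1"
    and K: "mono K" "\<And>x. 0 \<le> K x" "\<And>x. K x \<le> 1"
    and z: "\<And>q. q \<in> \<rat> \<Longrightarrow> 0 < q \<Longrightarrow> q < 1 \<Longrightarrow> K (z q) = q"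
    and lim: "\<And>q. q \<in> \<rat> \<Longrightarrow> 0 < q \<Longrightarrow> q < 1 \<Longrightarrow> (\<lambda>n. F n (z q)) \<longlonglongrightarrow> q"
  shows "(\<lambda>n. SUP x. \<bar>F n x - K x\<bar>) \<longlonglongrightarrow> 0"
proof (rule LIMSEQ_I)
  fix r :: real assume "0 < r"
  then obtain m :: nat where "3 / r < real m" using reals_Archimedean2 by blast
  moreover have "0 < 3 / r" using \<open>0 < r\<close> by simp
  ultimately have "0 < real m" by linarith
  then have m: "0 < m" "3 / real m < r"
    using \<open>3 / r < real m\<close> \<open>0 < r\<close> by (simp_all add: pos_divide_less_eq mult.commute)
  define y where "y = (\<lambda>j. z (real j / real m))"
  have q: "real j / real m \<in> \<rat>" "0 < real j / real m" "real j / real m < 1" if "j \<in> {1..<m}" for j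
    using that m by auto
  have Ky: "K (y j) = real j / real m" if "j \<in> {1..<m}" for j
    unfolding y_def by (rule z[OF q[OF that]])
  have "eventually (\<lambda>n. \<forall>j\<in>{1..<m}. dist (F n (y j)) (real j / real m) < 1 / real m) sequentially"
    using lim[OF q] m unfolding y_def by (intro eventually_ball_finite ballI tendstoD) auto
  then have ev: "eventually (\<lambda>n. n \<ge> 1 \<and> (\<forall>j\<in>{1..<m}. dist (F n (y j)) (real j / real m) < 1 / real m)) sequentially"
    by (intro eventually_conj eventually_ge_at_top)
  then obtain n0 where n0: "\<And>n. n \<ge> n0 \<Longrightarrow> n \<ge> 1 \<and> (\<forall>j\<in>{1..<m}. dist (F n (y j)) (real j / real m) < 1 / real m)"
    by (auto simp: eventually_sequentially)
  show "\<exists>n0. \<forall>n\<ge>n0. norm ((SUP x. \<bar>F n x - K x\<bar>) - 0) < r"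
  proof (intro exI allI impI)
    fix n assume "n \<ge> n0"
    then have n1: "n \<ge> 1" and near: "\<And>j. j \<in> {1..<m} \<Longrightarrow> \<bar>F n (y j) - real j / real m\<bar> < 1 / real m"
      using n0[of n] by (auto simp: dist_real_def)
    have mono: "x \<le> x' \<Longrightarrow> F n x \<le> F n x'" for x x' using F(1)[OF n1] by (auto dest: monoD)
    have close: "\<bar>F n x - K x\<bar> \<le> 3 / real m" for x
    proof -
      define j where "j = nat \<lfloor>real m * K x\<rfloor>"
      have "0 \<le> real m * K x" using K by simp
      then have "real j \<le> real m * K x" "real m * K x < real j + 1" unfolding j_def by linarith+
      then have j: "real j / real m \<le> K x" "K x < (real j + 1) / real m"
        using m by (auto simp: field_simps)
      have m3: "3 / real m = 1 / real m + 1 / real m + 1 / real m" by simp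
      have pos: "0 < 1 / real m" using m by simp
      have up: "(real j + 1) / real m = real j / real m + 1 / real m" by (rule add_divide_distrib)
      have upper: "F n x \<le> K x + 3 / real m"
      proof (cases "j + 1 < m")
        case True
        then have j1: "j + 1 \<in> {1..<m}" by simp
        have "K x < K (y (j + 1))" using Ky[OF j1] j(2) by (simp add: add.commute)
        then have "x \<le> y (j + 1)" using K(1) by (meson linorder_not_le monoD order_less_imp_le)
        then have "F n x \<le> F n (y (j + 1))" by (rule mono)
        also have "\<dots> < real (j + 1) / real m + 1 / real m" using near[OF j1] by linarith
        finally have "F n x < (real j + 1) / real m + 1 / real m" by (simp add: add.commute)
        then show ?thesis using up j(1) m3 pos by linarith
      next
        case False
        then have "1 \<le> (real j + 1) / real m" using m by (simp add: field_simps)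
        then show ?thesis using F(3)[of n x] up j(1) m3 pos by linarith
      qed
      have lower: "K x - 3 / real m \<le> F n x"
      proof (cases "2 \<le> j")
        case True
        have "real j / real m \<le> 1" using j(1) K(3)[of x] by linarith
        then have "j \<le> m" using m by (simp add: field_simps)
        then have j1: "j - 1 \<in> {1..<m}" using True by auto
        have j_eq: "real (j - 1) / real m = real j / real m - 1 / real m"
          using True by (simp add: of_nat_diff diff_divide_distrib)
        then have "K (y (j - 1)) < K x" using Ky[OF j1] j(1) pos by linarith
        then have "y (j - 1) \<le> x" using K(1) by (meson linorder_not_le monoD order_less_imp_le)
        then have "F n (y (j - 1)) \<le> F n x" by (rule mono)
        moreover have "real (j - 1) / real m - 1 / real m < F n (y (j - 1))" using near[OF j1] by linarith
        ultimately show ?thesis using j_eq up j(2) m3 by linarith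
      next
        case False
        then have "(real j + 1) / real m \<le> 2 / real m" by (intro divide_right_mono) auto
        moreover have "2 / real m \<le> 3 / real m" by (intro divide_right_mono) auto
        ultimately show ?thesis using F(2)[of n x] j(2) by linarith
      qed
      show ?thesis using upper lower by linarith
    qed
    have "(SUP x. \<bar>F n x - K x\<bar>) \<le> 3 / real m" by (rule cSUP_least) (use close in auto)
    moreover have "0 \<le> (SUP x. \<bar>F n x - K x\<bar>)"
      by (rule cSUP_upper2[of _ _ undefined]) (use close in \<open>auto simp: bdd_above_def\<close>)
    ultimately show "norm ((SUP x. \<bar>F n x - K x\<bar>) - 0) < r" using m by simp
  qed
qed

text \<open>
  The expected sum of the even powers \<open>(U n - E (U n)) ^ p\<close> is finite, so almost surely the sum is finite
  and its terms tend to \<open>0\<close>.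
\<close>
lemma (in prob_space) AE_tendsto_expectation_of_moments:
  fixes U :: "nat \<Rightarrow> 'a \<Rightarrow> real"
  assumes U: "\<And>n. U n \<in> borel_measurable M" "\<And>n \<omega>. 0 \<le> U n \<omega>" "\<And>n \<omega>. U n \<omega> \<le> 1"
    and p: "even p" "0 < p" and \<alpha>: "1 < \<alpha>"
    and moment: "\<And>n. n \<ge> 1 \<Longrightarrow> abs_central_moment M p (U n) \<le> K * real n powr (- \<alpha>)"
  shows "AE \<omega> in M. (\<lambda>n. U n \<omega> - expectation (U n)) \<longlonglongrightarrow> 0"
proof -
  define W where "W = (\<lambda>n \<omega>. (U n \<omega> - expectation (U n)) ^ p)"
  have W0: "0 \<le> W n \<omega>" for n \<omega> unfolding W_def using p(1) by (rule zero_le_even_power)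
  have W_meas [measurable]: "W n \<in> borel_measurable M" for n unfolding W_def using U(1) by measurable
  have U_int: "integrable M (U n)" for n by (rule integrable_const_bound[of _ 1]) (use U in auto)
  have EU: "0 \<le> expectation (U n)" "expectation (U n) \<le> 1" for n
  proof -
    show "0 \<le> expectation (U n)" using U by (intro Bochner_Integration.integral_nonneg) auto
    have "expectation (U n) \<le> expectation (\<lambda>_. 1)" using U U_int by (intro integral_mono) auto
    then show "expectation (U n) \<le> 1" by (simp add: prob_space)
  qed
  have W_int: "integrable M (W n)" for n
  proof (rule integrable_const_bound[of _ 1])
    have "\<bar>U n \<omega> - expectation (U n)\<bar> \<le> 1" for \<omega> using EU[of n] U(2,3)[of n \<omega>] by (simp add: abs_le_iff)
    then show "AE \<omega> in M. norm (W n \<omega>) \<le> 1" by (auto simp: W_def power_abs intro!: power_le_one)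
  qed simp
  have EW0: "0 \<le> expectation (W n)" for n by (rule Bochner_Integration.integral_nonneg) (rule W0)
  have "summable (\<lambda>n. K * real n powr (- \<alpha>))"
    using \<alpha> by (intro summable_mult) (simp add: summable_real_powr_iff)
  moreover have "norm (expectation (W n)) \<le> K * real n powr (- \<alpha>)" if "n \<ge> 1" for n
    using moment[OF that] by (simp add: abs_central_moment_def W_def)
  ultimately have "summable (\<lambda>n. expectation (W n))" by (rule summable_comparison_test'[where N = 1])
  then have "(\<Sum>n. ennreal (expectation (W n))) \<noteq> \<top>" using EW0 by (rule ennreal_suminf_neq_top)
  moreover have "(\<Sum>n. ennreal (expectation (W n))) = (\<Sum>n. \<integral>\<^sup>+\<omega>. ennreal (W n \<omega>) \<partial>M)"
    using W_int W0 by (simp add: nn_integral_eq_integral)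
  moreover have "\<dots> = (\<integral>\<^sup>+\<omega>. (\<Sum>n. ennreal (W n \<omega>)) \<partial>M)" by (rule nn_integral_suminf[symmetric]) simp
  ultimately have "(\<integral>\<^sup>+\<omega>. (\<Sum>n. ennreal (W n \<omega>)) \<partial>M) \<noteq> \<infinity>" by simp
  then have "AE \<omega> in M. (\<Sum>n. ennreal (W n \<omega>)) \<noteq> \<infinity>" by (intro nn_integral_PInf_AE) auto
  then show ?thesis
  proof eventually_elim
    case (elim \<omega>)
    then have "summable (\<lambda>n. W n \<omega>)" using W0 by (intro summable_suminf_not_top) auto
    then have "(\<lambda>n. W n \<omega>) \<longlonglongrightarrow> 0" by (rule summable_LIMSEQ_zero)
    then have "(\<lambda>n. root p (W n \<omega>)) \<longlonglongrightarrow> root p 0" by (rule tendsto_real_root)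
    moreover have "root p (W n \<omega>) = \<bar>U n \<omega> - expectation (U n)\<bar>" for n
    proof -
      have "W n \<omega> = \<bar>U n \<omega> - expectation (U n)\<bar> ^ p" unfolding W_def using p(1) by (rule power_even_abs[symmetric])
      then show ?thesis using p(2) by (simp add: real_root_power_cancel)
    qed
    ultimately show ?case by (simp add: tendsto_rabs_zero_iff)
  qed
qed

text \<open>
  Stationarity is stated for index sets of integers; here it is transported to tuples indexed from \<open>0\<close>.
\<close>
lemma distr_tuple_shift:
  assumes X: "\<And>t. X t \<in> borel_measurable M" and st: "strictly_stationary M X"
  shows "distr M (Pi\<^sub>M {..<u} (\<lambda>_. borel)) (tuple X u (\<lambda>j. h + int j))
    = distr M (Pi\<^sub>M {..<u} (\<lambda>_. borel)) (tuple X u (\<lambda>j. int j + 1))"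
proof -
  let ?J = "{1..int u}"
  let ?P = "Pi\<^sub>M ?J (\<lambda>_. borel) :: (int \<Rightarrow> real) measure" and ?Q = "Pi\<^sub>M {..<u} (\<lambda>_. borel) :: (nat \<Rightarrow> real) measure"
  define R where "R = (\<lambda>y :: int \<Rightarrow> real. \<lambda>j\<in>{..<u}. y (int j + 1))"
  have R: "R \<in> measurable ?P ?Q"
    unfolding R_def by (intro measurable_restrict measurable_component_singleton) auto
  have shift: "distr M ?Q (tuple X u (\<lambda>j. k + int j + 1)) = distr (distr M ?P (\<lambda>\<omega>. \<lambda>j\<in>?J. X (j + k) \<omega>)) ?Q R" for k
  proof -
    have meas: "(\<lambda>\<omega>. \<lambda>j\<in>?J. X (j + k) \<omega>) \<in> measurable M ?P" by (intro measurable_restrict X)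
    have "tuple X u (\<lambda>j. k + int j + 1) = R \<circ> (\<lambda>\<omega>. \<lambda>j\<in>?J. X (j + k) \<omega>)"
      by (auto simp: fun_eq_iff tuple_def R_def add_ac)
    then show ?thesis using distr_distr[OF R meas] by simp
  qed
  have "distr M ?P (\<lambda>\<omega>. \<lambda>j\<in>?J. X (j + (h - 1)) \<omega>) = distr M ?P (\<lambda>\<omega>. \<lambda>j\<in>?J. X (j + 0) \<omega>)"
    using st[unfolded strictly_stationary_def, rule_format, of ?J "h - 1"] by (simp only: add_0_right finite_atLeastAtMost_int)
  then show ?thesis using shift[of "h - 1"] shift[of 0] by simp
qed

text \<open>
  The function \<open>phi ((y - x) / \<epsilon>)\<close> of \<open>y\<close> lies between the indicators of \<open>y \<le> x\<close> and of
  \<open>y \<le> x + \<epsilon>\<close>, and by stationarity every block has the distribution of the first \<open>b\<close> observations.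
\<close>
lemma (in prob_space) expectation_phi_block_bounds:
  assumes X: "\<And>t. X t \<in> borel_measurable M" and st: "strictly_stationary M X"
    and s: "s b \<in> borel_measurable (Pi\<^sub>M {..<b} (\<lambda>_. borel))" and \<epsilon>: "0 < \<epsilon>"
  shows "stat_cdf M X s b x \<le> expectation (\<lambda>\<omega>. phi ((s b (block sch X b i \<omega>) - x) / \<epsilon>))" (is "_ \<le> expectation ?Z")
    and "expectation (\<lambda>\<omega>. phi ((s b (block sch X b i \<omega>) - x) / \<epsilon>)) \<le> stat_cdf M X s b (x + \<epsilon>)"
proof -
  let ?Q = "Pi\<^sub>M {..<b} (\<lambda>_. borel) :: (nat \<Rightarrow> real) measure"
  define A where "A = (\<lambda>y. {\<omega> \<in> space M. s b (block sch X b i \<omega>) \<le> y})"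
  have block_meas: "block sch X b i \<in> measurable M ?Q"
    unfolding block_eq_tuple by (rule tuple_measurable) (rule X)
  have A_meas [measurable]: "A y \<in> sets M" for y
    unfolding A_def using measurable_compose[OF block_meas s] by measurable
  have prob_A: "prob (A y) = stat_cdf M X s b y" for y
  proof -
    let ?B = "{z \<in> space ?Q. s b z \<le> y}"
    have B: "?B \<in> sets ?Q" using s by measurable
    have "prob (A y) = measure (distr M ?Q (block sch X b i)) ?B"
      using measurable_space[OF block_meas]
      by (subst measure_distr[OF block_meas B]) (auto simp: A_def intro!: arg_cong[of _ _ prob])
    also have "distr M ?Q (block sch X b i) = distr M ?Q (tuple X b (\<lambda>j. int j + 1))"
      unfolding block_eq_tuple by (rule distr_tuple_shift[OF X st])
    also have "measure \<dots> ?B = stat_cdf M X s b y"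
    proof -
      have meas: "tuple X b (\<lambda>j. int j + 1) \<in> measurable M ?Q" by (rule tuple_measurable) (rule X)
      show ?thesis using measurable_space[OF meas]
        by (subst measure_distr[OF meas B]) (auto simp: stat_cdf_def intro!: arg_cong[of _ _ prob])
    qed
    finally show ?thesis .
  qed
  have Z_int: "integrable M ?Z"
    by (rule integrable_const_bound[of _ 1])
      (use phi_block_measurable[of X M s b, OF X s] phi_nonneg phi_le_1 in auto)
  have ind_int: "integrable M (indicator (A y) :: 'a \<Rightarrow> real)" for y
    by (rule integrable_real_indicator[OF A_meas]) (simp add: emeasure_eq_measure)
  have "expectation (indicator (A x)) \<le> expectation ?Z"
    by (rule integral_mono[OF ind_int Z_int])
      (use \<epsilon> in \<open>auto simp: indicator_def A_def phi_def divide_le_0_iff\<close>)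
  then show "stat_cdf M X s b x \<le> expectation ?Z" by (simp add: prob_A)
  have "expectation ?Z \<le> expectation (indicator (A (x + \<epsilon>)))"
    by (rule integral_mono[OF Z_int ind_int])
      (use \<epsilon> in \<open>auto simp: indicator_def A_def phi_def le_divide_eq divide_le_0_iff\<close>)
  then show "expectation ?Z \<le> stat_cdf M X s b (x + \<epsilon>)" by (simp add: prob_A)
qed

lemma (in prob_space) expectation_smooth_subsampling_bounds:
  assumes X: "\<And>t. X t \<in> borel_measurable M" and st: "strictly_stationary M X"
    and s: "s b \<in> borel_measurable (Pi\<^sub>M {..<b} (\<lambda>_. borel))" and \<epsilon>: "0 < \<epsilon>"
    and N: "1 \<le> num_blocks sch b n"
  shows "expectation (smooth_subsampling sch X s b \<epsilon> n x) \<in> {stat_cdf M X s b x..stat_cdf M X s b (x + \<epsilon>)}"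
proof -
  let ?N = "num_blocks sch b n" and ?Z = "\<lambda>i \<omega>. phi ((s b (block sch X b i \<omega>) - x) / \<epsilon>)"
  have Z_int: "integrable M (?Z i)" for i
    by (rule integrable_const_bound[of _ 1])
      (use phi_block_measurable[of X M s b, OF X s] phi_nonneg phi_le_1 in auto)
  have "expectation (smooth_subsampling sch X s b \<epsilon> n x) = (\<Sum>i<?N. expectation (?Z i)) / real ?N"
    unfolding smooth_subsampling_def[abs_def] using Z_int by simp
  moreover have "real ?N * stat_cdf M X s b x \<le> (\<Sum>i<?N. expectation (?Z i))"
    using sum_bounded_below[of "{..<?N}" "stat_cdf M X s b x" "\<lambda>i. expectation (?Z i)"]
      expectation_phi_block_bounds(1)[of X s b, OF X st s \<epsilon>] by simp
  moreover have "(\<Sum>i<?N. expectation (?Z i)) \<le> real ?N * stat_cdf M X s b (x + \<epsilon>)"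
    using sum_bounded_above[of "{..<?N}" "\<lambda>i. expectation (?Z i)" "stat_cdf M X s b (x + \<epsilon>)"]
      expectation_phi_block_bounds(2)[of X s b, OF X st s \<epsilon>] by simp
  ultimately show ?thesis using N by (simp add: pos_le_divide_eq pos_divide_le_eq mult.commute)
qed

lemma mono_smooth_subsampling:
  assumes "0 < \<epsilon>"
  shows "mono (\<lambda>x. smooth_subsampling sch X s b \<epsilon> n x \<omega>)"
  unfolding smooth_subsampling_def
  by (intro monoI divide_right_mono sum_mono phi_antimono) (use assms in \<open>auto intro: divide_right_mono\<close>)

lemma prob_density_imp_real_distribution:
  assumes "prob_space (density lborel f)"
  shows "real_distribution (density lborel f)"
  using assms by (simp add: real_distribution_def real_distribution_axioms_def)

lemma isCont_cdf_density:
  assumes f: "f \<in> borel_measurable lborel" and "prob_space (density lborel f)"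
  shows "isCont (cdf (density lborel f)) x"
proof -
  interpret real_distribution "density lborel f" by (rule prob_density_imp_real_distribution) fact
  have "AE y in lborel. f y * indicator {x} y = 0"
    using AE_lborel_singleton[of x] by eventually_elim simp
  then have "emeasure (density lborel f) {x} = 0"
    using f by (simp add: emeasure_density nn_integral_0_iff_AE)
  then show ?thesis by (simp add: isCont_cdf measure_def)
qed

lemma (in real_distribution) ex_cdf_eq:
  assumes "\<And>x. isCont (cdf M) x" and q: "0 < q" "q < 1"
  shows "\<exists>x. cdf M x = q"
proof -
  have "eventually (\<lambda>x. cdf M x < q) at_bot" using cdf_lim_at_bot q by (simp add: order_tendstoD)
  then obtain a where a: "\<And>x. x \<le> a \<Longrightarrow> cdf M x < q" by (auto simp: eventually_at_bot_linorder)
  have "eventually (\<lambda>x. q < cdf M x) at_top" using cdf_lim_at_top_prob q by (simp add: order_tendstoD)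
  then obtain c where c: "\<And>x. c \<le> x \<Longrightarrow> q < cdf M x" by (auto simp: eventually_at_top_linorder)
  have "\<exists>x\<ge>min a c. x \<le> c \<and> cdf M x = q"
    by (rule IVT) (use a[of "min a c"] c[of c] assms in \<open>auto intro: less_imp_le\<close>)
  then show ?thesis by blast
qed

text \<open>
  The bias vanishes because \<open>cdf Q\<close> is continuous and the distribution functions of the statistics
  converge to it uniformly, hence also along \<open>b n\<close> at the moving points \<open>x + \<epsilon> n\<close>.
\<close>
lemma (in prob_space) AE_uniform_convergence_smooth_subsampling:
  fixes X :: "int \<Rightarrow> 'a \<Rightarrow> real" and s :: "nat \<Rightarrow> (nat \<Rightarrow> real) \<Rightarrow> real" and b :: "nat \<Rightarrow> nat"
    and \<epsilon> :: "nat \<Rightarrow> real" and sch :: scheme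
  defines "U \<equiv> \<lambda>n. smooth_subsampling sch X s (b n) (\<epsilon> n) n"
  assumes X: "\<And>t. X t \<in> borel_measurable M" and st: "strictly_stationary M X"
    and s: "\<And>n. n \<ge> 1 \<Longrightarrow> s n \<in> borel_measurable (Pi\<^sub>M {..<n} (\<lambda>_. borel))"
    and b: "\<And>n. n \<ge> 1 \<Longrightarrow> b n > 0" "filterlim b at_top sequentially"
      "filterlim (\<lambda>n. real n / real (b n)) at_top sequentially"
    and \<epsilon>: "\<And>n. n \<ge> 1 \<Longrightarrow> \<epsilon> n > 0" "\<epsilon> \<longlonglongrightarrow> 0"
    and K: "real_distribution Q" "\<And>x. isCont (cdf Q) x"
    and r: "(\<lambda>n. SUP x. \<bar>stat_cdf M X s n x - cdf Q x\<bar>) \<longlonglongrightarrow> 0"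
    and moment: "even p" "0 < p" "1 < \<alpha>"
      "\<And>n x. n \<ge> 1 \<Longrightarrow> abs_central_moment M p (U n x) \<le> A * real n powr (- \<alpha>)"
  shows "AE \<omega> in M. (\<lambda>n. SUP x. \<bar>U n x \<omega> - cdf Q x\<bar>) \<longlonglongrightarrow> 0"
proof -
  interpret Q: real_distribution Q by (rule K(1))
  define R where "R = (\<lambda>n. SUP x. \<bar>stat_cdf M X s n x - cdf Q x\<bar>)"
  have cdf_bounds: "0 \<le> cdf Q x" "cdf Q x \<le> 1" for x
    by (simp_all add: Q.cdf_nonneg Q.cdf_bounded_prob)
  have near: "\<bar>stat_cdf M X s n x - cdf Q x\<bar> \<le> R n" for n x
    unfolding R_def
  proof (rule cSUP_upper)
    have "\<bar>stat_cdf M X s n x - cdf Q x\<bar> \<le> 1" for x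
    proof -
      have "0 \<le> stat_cdf M X s n x" "stat_cdf M X s n x \<le> 1" by (simp_all add: stat_cdf_def)
      then show ?thesis using cdf_bounds[of x] by linarith
    qed
    then show "bdd_above (range (\<lambda>x. \<bar>stat_cdf M X s n x - cdf Q x\<bar>))" by (auto simp: bdd_above_def)
  qed simp
  have Rb: "(\<lambda>n. R (b n)) \<longlonglongrightarrow> 0"
    using r unfolding R_def[symmetric] by (rule filterlim_compose[OF _ b(2)])
  have U_meas: "U n x \<in> borel_measurable M" if "n \<ge> 1" for n x
    unfolding U_def using b(1)[OF that] by (intro smooth_subsampling_measurable X s) simp
  have bias: "(\<lambda>n. expectation (U n x)) \<longlonglongrightarrow> cdf Q x" for x
  proof (rule tendsto_sandwich)
    have "eventually (\<lambda>n. 2 \<le> real n / real (b n)) sequentially"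
      using b(3) by (simp add: filterlim_at_top)
    then have "eventually (\<lambda>n. n \<ge> 1 \<and> 2 \<le> real n / real (b n)) sequentially"
      by (intro eventually_conj eventually_ge_at_top)
    then have ev: "eventually (\<lambda>n. expectation (U n x) \<in> {cdf Q x - R (b n)..cdf Q (x + \<epsilon> n) + R (b n)}) sequentially"
    proof eventually_elim
      case (elim n)
      then have n: "n \<ge> 1" by simp
      have "2 * real (b n) \<le> real n" using elim b(1)[OF n] by (simp add: pos_le_divide_eq)
      then have "2 * b n \<le> n" by linarith
      then have "1 \<le> num_blocks sch (b n) n" using b(1)[OF n] by (intro num_blocks_bounds) simp_all
      then have "expectation (U n x) \<in> {stat_cdf M X s (b n) x..stat_cdf M X s (b n) (x + \<epsilon> n)}"
        unfolding U_def using b(1)[OF n] \<epsilon>(1)[OF n]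
        by (intro expectation_smooth_subsampling_bounds X st s) simp_all
      then show ?case using near[of "b n" x] near[of "b n" "x + \<epsilon> n"] by auto
    qed
    then show "eventually (\<lambda>n. cdf Q x - R (b n) \<le> expectation (U n x)) sequentially"
      by eventually_elim simp
    show "eventually (\<lambda>n. expectation (U n x) \<le> cdf Q (x + \<epsilon> n) + R (b n)) sequentially"
      using ev by eventually_elim simp
    show "(\<lambda>n. cdf Q x - R (b n)) \<longlonglongrightarrow> cdf Q x" using tendsto_diff[OF tendsto_const Rb] by simp
    have "(\<lambda>n. x + \<epsilon> n) \<longlonglongrightarrow> x" using tendsto_add[OF tendsto_const \<epsilon>(2)] by simp
    then have "(\<lambda>n. cdf Q (x + \<epsilon> n)) \<longlonglongrightarrow> cdf Q x" by (rule isCont_tendsto_compose[OF K(2)])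
    from tendsto_add[OF this Rb] show "(\<lambda>n. cdf Q (x + \<epsilon> n) + R (b n)) \<longlonglongrightarrow> cdf Q x" by simp
  qed
  have U_bounds: "0 \<le> U n x \<omega>" "U n x \<omega> \<le> 1" for n x \<omega>
    unfolding U_def by (rule smooth_subsampling_bounds)+
  have pointwise: "AE \<omega> in M. (\<lambda>n. U n x \<omega>) \<longlonglongrightarrow> cdf Q x" for x
  proof -
    have "U 0 x = (\<lambda>_. 0)" by (cases sch) (simp_all add: U_def smooth_subsampling_def fun_eq_iff)
    then have meas: "U n x \<in> borel_measurable M" for n by (cases "n = 0") (auto intro: U_meas)
    have "AE \<omega> in M. (\<lambda>n. U n x \<omega> - expectation (U n x)) \<longlonglongrightarrow> 0"
      by (rule AE_tendsto_expectation_of_moments[OF meas U_bounds moment(1-3)]) (rule moment(4))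
    then show ?thesis
    proof eventually_elim
      case (elim \<omega>)
      show ?case using tendsto_add[OF elim bias[of x]] by simp
    qed
  qed
  \<comment> \<open>a choice of quantiles; rational levels suffice, and there are countably many\<close>
  define z where "z = (\<lambda>q. SOME x. cdf Q x = q)"
  have z: "cdf Q (z q) = q" if "0 < q" "q < 1" for q
    unfolding z_def by (rule someI_ex) (rule Q.ex_cdf_eq[OF K(2) that])
  have "AE \<omega> in M. \<forall>q\<in>\<rat>. (\<lambda>n. U n (z q) \<omega>) \<longlonglongrightarrow> cdf Q (z q)"
    by (rule AE_ball_countable'[OF pointwise countable_rat])
  then show ?thesis
  proof eventually_elim
    case (elim \<omega>)
    show ?case
    proof (rule polya_uniform_convergence[where z = z])
      show "mono (\<lambda>x. U n x \<omega>)" if "n \<ge> 1" for n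
        unfolding U_def by (rule mono_smooth_subsampling[OF \<epsilon>(1)[OF that]])
      show "mono (cdf Q)" by (rule monoI) (rule Q.cdf_nondecreasing)
      show "(\<lambda>n. U n (z q) \<omega>) \<longlonglongrightarrow> q" if "q \<in> \<rat>" "0 < q" "q < 1" for q
        using elim that z[OF that(2,3)] by auto
    qed (use U_bounds cdf_bounds z in auto)
  qed
qed

section \<open>The four sets of conditions in terms of real numbers\<close>

text \<open>
  A partial sum can only be finite if its terms are, and all weights are positive; so the coefficients
  are real numbers.
\<close>
lemma ex_real_coefficients:
  fixes coeff :: "nat \<Rightarrow> ennreal"
  assumes p: "2 \<le> (p::nat)"
    and fin: "\<And>n. (\<Sum>t<n. ennreal (real (t + 1) powr (real p - 2)) * coeff t) < \<infinity>"
  obtains e where "\<And>t. coeff t = ennreal (e t)" "\<And>t. 0 \<le> e t"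
    and "\<And>n. (\<Sum>t<n. ennreal (real (t + 1) powr (real p - 2)) * coeff t)
      = ennreal (\<Sum>t<n. real (t + 1) ^ (p - 2) * e t)"
proof -
  have weight: "real (t + 1) powr (real p - 2) = real (t + 1) ^ (p - 2)" for t
    using p by (simp add: of_nat_diff flip: powr_realpow)
  have coeff_fin: "coeff t < \<infinity>" for t
  proof (rule ccontr)
    assume "\<not> coeff t < \<infinity>"
    then have "ennreal (real (t + 1) powr (real p - 2)) * coeff t = \<infinity>"
      by (simp add: less_top[symmetric] ennreal_mult_top)
    moreover have "ennreal (real (t + 1) powr (real p - 2)) * coeff t
        \<le> (\<Sum>t<Suc t. ennreal (real (t + 1) powr (real p - 2)) * coeff t)" by simp
    ultimately show False using fin[of "Suc t"] by (simp add: top_unique)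
  qed
  define e where "e = (\<lambda>t. enn2real (coeff t))"
  have coeff: "coeff t = ennreal (e t)" for t using coeff_fin[of t] by (simp add: e_def)
  have e0: "0 \<le> e t" for t by (simp add: e_def)
  show thesis
  proof (rule that[OF coeff e0])
    fix n
    show "(\<Sum>t<n. ennreal (real (t + 1) powr (real p - 2)) * coeff t)
      = ennreal (\<Sum>t<n. real (t + 1) ^ (p - 2) * e t)"
      unfolding weight coeff using e0 by (simp add: ennreal_mult' sum_nonneg flip: sum_ennreal)
  qed
qed

text \<open>
  The rate condition makes the Lipschitz constants finite. \<open>R\<close> stands for any of the four maxima, of
  which only three lower bounds matter: \<open>1\<close>, \<open>L / \<epsilon>\<close>, and for \<open>\<kappa> = 1\<close> also \<open>b * L\<^sup>2 / \<epsilon>\<^sup>2\<close>.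
\<close>
lemma ex_real_rate:
  fixes b :: "nat \<Rightarrow> nat" and \<epsilon> :: "nat \<Rightarrow> real" and L R :: "nat \<Rightarrow> ennreal"
  assumes b: "\<And>n. n \<ge> 1 \<Longrightarrow> b n > 0" and \<epsilon>: "\<And>n. n \<ge> 1 \<Longrightarrow> \<epsilon> n > 0" and \<kappa>: "0 \<le> \<kappa>"
    and R: "\<And>n. n \<ge> 1 \<Longrightarrow> 1 \<le> R n" "\<And>n. n \<ge> 1 \<Longrightarrow> L (b n) / ennreal (\<epsilon> n) \<le> R n"
      "\<And>n. n \<ge> 1 \<Longrightarrow> ennreal \<kappa> * (of_nat (b n) * (L (b n))\<^sup>2 / (ennreal (\<epsilon> n))\<^sup>2) \<le> R n"
    and rate: "(\<lambda>n. ennreal (real (b n) / real n) * R n) \<prec> (\<lambda>n. ennreal (real n powr (- \<delta>)))"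
  shows "\<exists>c l \<Lambda>. (\<forall>n. 0 \<le> l n) \<and> (\<forall>n\<ge>1. L (b n) = ennreal (l n) \<and> 1 \<le> \<Lambda> n \<and> l n / \<epsilon> n \<le> \<Lambda> n
    \<and> \<kappa> * real (b n) * (l n / \<epsilon> n)\<^sup>2 \<le> \<Lambda> n \<and> real (b n) / real n * \<Lambda> n \<le> c * real n powr (- \<delta>))"
proof -
  obtain c where c: "0 < c" "\<And>n. n \<ge> 1 \<Longrightarrow> ennreal (real (b n) / real n) * R n \<le> ennreal c * ennreal (real n powr (- \<delta>))"
    using rate by (auto simp: asymp_le_def)
  have R_fin: "R n < \<top>" if n: "n \<ge> 1" for n
  proof (rule ccontr)
    assume "\<not> R n < \<top>"
    then have "R n = \<top>" by (simp add: less_top[symmetric])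
    then have "ennreal (real (b n) / real n) * R n = \<top>" using b n by (simp add: ennreal_mult_top)
    moreover have "ennreal c * ennreal (real n powr (- \<delta>)) < \<top>" by (simp add: ennreal_mult_less_top)
    ultimately show False using c(2)[OF n] by (simp add: top_unique)
  qed
  have L_fin: "L (b n) < \<top>" if n: "n \<ge> 1" for n
  proof (rule ccontr)
    assume "\<not> L (b n) < \<top>"
    then have "L (b n) / ennreal (\<epsilon> n) = \<top>" by (simp add: less_top[symmetric] ennreal_top_divide)
    then show False using R(2)[OF n] R_fin[OF n] by (simp add: top_unique)
  qed
  define l \<Lambda> where "l = (\<lambda>n. enn2real (L (b n)))" and "\<Lambda> = (\<lambda>n. enn2real (R n))"
  have l: "L (b n) = ennreal (l n)" if "n \<ge> 1" for n using L_fin[OF that] by (simp add: l_def)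
  have \<Lambda>: "R n = ennreal (\<Lambda> n)" if "n \<ge> 1" for n using R_fin[OF that] by (simp add: \<Lambda>_def)
  have l0: "0 \<le> l n" and \<Lambda>0: "0 \<le> \<Lambda> n" for n by (simp_all add: l_def \<Lambda>_def)
  show ?thesis
  proof (rule exI[of _ c], rule exI[of _ l], rule exI[of _ \<Lambda>], intro conjI allI impI)
    show "0 \<le> l n" for n by (rule l0)
    fix n :: nat assume n: "n \<ge> 1"
    show "L (b n) = ennreal (l n)" by (rule l[OF n])
    show "1 \<le> \<Lambda> n" using R(1)[OF n] \<Lambda>0[of n] unfolding \<Lambda>[OF n] by (simp flip: ennreal_1)
    show "l n / \<epsilon> n \<le> \<Lambda> n"
      using R(2)[OF n] \<Lambda>0[of n] l0[of n] \<epsilon>[OF n] unfolding \<Lambda>[OF n] l[OF n] by (simp add: divide_ennreal)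
    have "ennreal \<kappa> * (of_nat (b n) * (L (b n))\<^sup>2 / (ennreal (\<epsilon> n))\<^sup>2) = ennreal (\<kappa> * (real (b n) * (l n)\<^sup>2 / (\<epsilon> n)\<^sup>2))"
      unfolding l[OF n] ennreal_of_nat_eq_real_of_nat using l0[of n] \<epsilon>[OF n] \<kappa>
      by (simp add: ennreal_power divide_ennreal flip: ennreal_mult)
    then show "\<kappa> * real (b n) * (l n / \<epsilon> n)\<^sup>2 \<le> \<Lambda> n"
      using R(3)[OF n] \<Lambda>0[of n] unfolding \<Lambda>[OF n] by (simp add: power_divide mult.assoc)
    have "ennreal (real (b n) / real n * \<Lambda> n) \<le> ennreal (c * real n powr (- \<delta>))"
    proof -
      have "ennreal (real (b n) / real n * \<Lambda> n) = ennreal (real (b n) / real n) * ennreal (\<Lambda> n)"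
        by (rule ennreal_mult') simp
      also have "\<dots> \<le> ennreal c * ennreal (real n powr (- \<delta>))" using c(2)[OF n] unfolding \<Lambda>[OF n] .
      also have "\<dots> = ennreal (c * real n powr (- \<delta>))" by (rule ennreal_mult'[symmetric]) (use c(1) in simp)
      finally show ?thesis .
    qed
    then show "real (b n) / real n * \<Lambda> n \<le> c * real n powr (- \<delta>)"
      using c(1) by (subst (asm) ennreal_le_iff) auto
  qed
qed

theorem theorem1:
  fixes M :: "'w measure"
    and X :: "int \<Rightarrow> 'w \<Rightarrow> real"
    and s :: "nat \<Rightarrow> (nat \<Rightarrow> real) \<Rightarrow> real"
    and K K' :: "real \<Rightarrow> real"
    and b :: "nat \<Rightarrow> nat"
    and \<epsilon> :: "nat \<Rightarrow> real"
    and \<delta> :: real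
    and p :: nat
    and sch :: scheme
  defines "L \<equiv> \<lambda>m. Lip m (s m)"
    and "Kt \<equiv> \<lambda>n. smooth_subsampling sch X s (b n) (\<epsilon> n) n"
  assumes "prob_space M"
    and "\<And>t. X t \<in> borel_measurable M"
    and "strictly_stationary M X"
    and "\<And>n. n \<ge> 1 \<Longrightarrow> s n \<in> borel_measurable (Pi\<^sub>M {..<n} (\<lambda>_. borel))"
    and "\<And>n. n \<ge> 1 \<Longrightarrow> b n > 0"
    and "filterlim b at_top sequentially"
    and "filterlim (\<lambda>n. real n / real (b n)) at_top sequentially"
    and "\<And>n. n \<ge> 1 \<Longrightarrow> \<epsilon> n > 0"
    and "\<And>m n. 1 \<le> m \<Longrightarrow> m \<le> n \<Longrightarrow> \<epsilon> n \<le> \<epsilon> m"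
    and "\<epsilon> \<longlonglongrightarrow> 0"
    and "(\<lambda>n. SUP x. \<bar>stat_cdf M X s n x - K x\<bar>) \<longlonglongrightarrow> 0"
    and "K' \<in> borel_measurable lborel"
    and "prob_space (density lborel (\<lambda>x. ennreal (K' x)))"
    and "K = cdf (density lborel (\<lambda>x. ennreal (K' x)))"
    and "\<exists>C. AE x in lborel. 0 \<le> K' x \<and> K' x \<le> C"
    and "\<delta> > 0"
    and "p \<ge> 1"
    and "(sch = Overlapping \<and> eta_weakly_dependent M X \<and>
          (\<Sum>t. ennreal (real (t + 1) powr (real p - 2)) * eta_coeff M X t) < \<infinity> \<and>
          (\<lambda>n. ennreal (real (b n) / real n) * max 1 (L (b n) / ennreal (\<epsilon> n)))
            \<prec> (\<lambda>n. ennreal (real n powr (- \<delta>))))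
       \<or> (sch = Overlapping \<and> lambda_weakly_dependent M X \<and>
          (\<Sum>t. ennreal (real (t + 1) powr (real p - 2)) * lambda_coeff M X t) < \<infinity> \<and>
          (\<lambda>n. ennreal (real (b n) / real n) *
                max (max 1 (L (b n) / ennreal (\<epsilon> n)))
                    (of_nat (b n) * (L (b n))\<^sup>2 / (ennreal (\<epsilon> n))\<^sup>2))
            \<prec> (\<lambda>n. ennreal (real n powr (- \<delta>))))
       \<or> (sch = Nonoverlapping \<and> eta_weakly_dependent M X \<and>
          (\<lambda>n. \<Sum>t<n. ennreal (real (t + 1) powr (real p - 2)) * eta_coeff M X t)
            \<prec> (\<lambda>n. ennreal (real (b n) powr (real p - 2))) \<and>
          (\<lambda>n. ennreal (real (b n) / real n) *
                max 1 (of_nat (b n) * L (b n) / ennreal (\<epsilon> n)))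
            \<prec> (\<lambda>n. ennreal (real n powr (- \<delta>))))
       \<or> (sch = Nonoverlapping \<and> lambda_weakly_dependent M X \<and>
          (\<lambda>n. \<Sum>t<n. ennreal (real (t + 1) powr (real p - 2)) * lambda_coeff M X t)
            \<prec> (\<lambda>n. ennreal (real (b n) powr (real p - 2))) \<and>
          (\<lambda>n. ennreal (real (b n) / real n) *
                max (max 1 (of_nat (b n) * L (b n) / ennreal (\<epsilon> n)))
                    (of_nat (b n) * (L (b n))\<^sup>2 / (ennreal (\<epsilon> n))\<^sup>2))
            \<prec> (\<lambda>n. ennreal (real n powr (- \<delta>))))"
  shows "(\<forall>x. (\<lambda>n. ennreal (abs_central_moment M p (Kt n x)))
                \<prec> (\<lambda>n. ennreal (real n powr (- (real (p div 2) * \<delta>)))))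
       \<and> (even p \<and> real p * \<delta> > 2 \<longrightarrow>
            (AE \<omega> in M. (\<lambda>n. SUP x. \<bar>Kt n x \<omega> - K x\<bar>) \<longlonglongrightarrow> 0))"
proof -
  interpret prob_space M by fact
  note X = assms(4) and st = assms(5) and s = assms(6) and b = assms(7-9) and \<epsilon> = assms(10,12)
    and r = assms(13) and K' = assms(14-16) and \<delta> = assms(18) and p = assms(19) and cases = assms(20)
  note L_def = assms(1) and Kt_def = assms(2)
  show ?thesis
  proof (cases "p = 1")
    case True
    \<comment> \<open>a first central moment vanishes; for \<open>p \<ge> 2\<close> the weight is a power of \<open>t + 1\<close> with a natural exponent\<close>
    have "abs_central_moment M p (Kt n x) = 0" if n: "n \<ge> 1" for n x
    proof -
      have "Kt n x \<in> borel_measurable M"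
        unfolding Kt_def using b(1)[OF n] by (intro smooth_subsampling_measurable X s) simp
      then have "integrable M (Kt n x)"
        by (intro integrable_const_bound[of _ 1]) (auto simp: Kt_def smooth_subsampling_bounds)
      then show ?thesis by (simp add: True abs_central_moment_def prob_space)
    qed
    then show ?thesis using True by (auto simp: asymp_le_def intro!: exI[of _ "1::real"])
  next
    case False
    then have p2: "2 \<le> p" using p by simp
    have of_nat_b: "L (b n) / ennreal (\<epsilon> n) \<le> of_nat (b n) * L (b n) / ennreal (\<epsilon> n)" if "n \<ge> 1" for n
    proof -
      have "1 * L (b n) \<le> of_nat (b n) * L (b n)"
        using b(1)[OF that] by (intro mult_right_mono) auto
      then show ?thesis by (simp add: divide_right_mono_ennreal)
    qed
    define coeff where "coeff = (\<lambda>\<kappa>. mixed_coeff \<kappa> M X)"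
    define S where "S = (\<lambda>\<kappa> n. \<Sum>t<n. ennreal (real (t + 1) powr (real p - 2)) * coeff \<kappa> t)"
    \<comment> \<open>the common content of the four sets of conditions\<close>
    have "\<exists>\<kappa> R D. 0 \<le> \<kappa> \<and> 0 \<le> D \<and>
        (\<forall>n\<ge>1. 1 \<le> R n \<and> L (b n) / ennreal (\<epsilon> n) \<le> R n
          \<and> ennreal \<kappa> * (of_nat (b n) * (L (b n))\<^sup>2 / (ennreal (\<epsilon> n))\<^sup>2) \<le> R n) \<and>
        (\<lambda>n. ennreal (real (b n) / real n) * R n) \<prec> (\<lambda>n. ennreal (real n powr (- \<delta>))) \<and>
        (\<forall>n\<ge>1. S \<kappa> n \<le> ennreal (D * (case sch of Overlapping \<Rightarrow> 1 | Nonoverlapping \<Rightarrow> real (b n) ^ (p - 2))))"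
    proof -
      have overlapping: "\<exists>D\<ge>0. \<forall>n\<ge>1. S \<kappa> n \<le> ennreal (D * (case sch of Overlapping \<Rightarrow> 1 | Nonoverlapping \<Rightarrow> real (b n) ^ (p - 2)))"
        if "sch = Overlapping" "(\<Sum>t. ennreal (real (t + 1) powr (real p - 2)) * coeff \<kappa> t) < \<infinity>" for \<kappa>
      proof -
        let ?T = "\<Sum>t. ennreal (real (t + 1) powr (real p - 2)) * coeff \<kappa> t"
        have "S \<kappa> n \<le> ?T" for n unfolding S_def by (rule sum_le_suminf) auto
        moreover have "?T = ennreal (enn2real ?T)" using that(2) by simp
        ultimately show ?thesis using that(1) by (intro exI[of _ "enn2real ?T"]) simp
      qed
      have nonoverlapping: "\<exists>D\<ge>0. \<forall>n\<ge>1. S \<kappa> n \<le> ennreal (D * (case sch of Overlapping \<Rightarrow> 1 | Nonoverlapping \<Rightarrow> real (b n) ^ (p - 2)))"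
        if non: "sch = Nonoverlapping" and S: "S \<kappa> \<prec> (\<lambda>n. ennreal (real (b n) powr (real p - 2)))" for \<kappa>
      proof -
        obtain D where D: "0 < D" "\<And>n. n \<ge> 1 \<Longrightarrow> S \<kappa> n \<le> ennreal D * ennreal (real (b n) powr (real p - 2))"
          using S by (auto simp: asymp_le_def)
        have "S \<kappa> n \<le> ennreal (D * real (b n) ^ (p - 2))" if "n \<ge> 1" for n
          using D(1) D(2)[OF that] b(1)[OF that] p2 by (simp add: ennreal_mult' of_nat_diff flip: powr_realpow)
        then show ?thesis using non D(1) by (intro exI[of _ D]) simp
      qed
      from cases show ?thesis
        unfolding eta_coeff_eq_mixed lambda_coeff_eq_mixed
      proof (elim disjE conjE)
        assume *: "sch = Overlapping" "(\<Sum>t. ennreal (real (t + 1) powr (real p - 2)) * mixed_coeff 0 M X t) < \<infinity>"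
          "(\<lambda>n. ennreal (real (b n) / real n) * max 1 (L (b n) / ennreal (\<epsilon> n))) \<prec> (\<lambda>n. ennreal (real n powr (- \<delta>)))"
        obtain D where "0 \<le> D" "\<forall>n\<ge>1. S 0 n \<le> ennreal (D * (case sch of Overlapping \<Rightarrow> 1 | Nonoverlapping \<Rightarrow> real (b n) ^ (p - 2)))"
          using overlapping[of 0] * unfolding coeff_def by blast
        then show ?thesis
          by (intro exI[of _ 0] exI[of _ "\<lambda>n. max 1 (L (b n) / ennreal (\<epsilon> n))"] exI[of _ D]) (use * in simp)
      next
        assume *: "sch = Overlapping" "(\<Sum>t. ennreal (real (t + 1) powr (real p - 2)) * mixed_coeff 1 M X t) < \<infinity>"
          "(\<lambda>n. ennreal (real (b n) / real n) * max (max 1 (L (b n) / ennreal (\<epsilon> n)))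
              (of_nat (b n) * (L (b n))\<^sup>2 / (ennreal (\<epsilon> n))\<^sup>2)) \<prec> (\<lambda>n. ennreal (real n powr (- \<delta>)))"
        obtain D where "0 \<le> D" "\<forall>n\<ge>1. S 1 n \<le> ennreal (D * (case sch of Overlapping \<Rightarrow> 1 | Nonoverlapping \<Rightarrow> real (b n) ^ (p - 2)))"
          using overlapping[of 1] * unfolding coeff_def by blast
        then show ?thesis
          by (intro exI[of _ 1] exI[of _ "\<lambda>n. max (max 1 (L (b n) / ennreal (\<epsilon> n)))
              (of_nat (b n) * (L (b n))\<^sup>2 / (ennreal (\<epsilon> n))\<^sup>2)"] exI[of _ D])
            (use * in \<open>simp add: le_max_iff_disj\<close>)
      next
        assume *: "sch = Nonoverlapping"
          "(\<lambda>n. \<Sum>t<n. ennreal (real (t + 1) powr (real p - 2)) * mixed_coeff 0 M X t) \<prec> (\<lambda>n. ennreal (real (b n) powr (real p - 2)))"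
          "(\<lambda>n. ennreal (real (b n) / real n) * max 1 (of_nat (b n) * L (b n) / ennreal (\<epsilon> n))) \<prec> (\<lambda>n. ennreal (real n powr (- \<delta>)))"
        obtain D where "0 \<le> D" "\<forall>n\<ge>1. S 0 n \<le> ennreal (D * (case sch of Overlapping \<Rightarrow> 1 | Nonoverlapping \<Rightarrow> real (b n) ^ (p - 2)))"
          using nonoverlapping[of 0] * unfolding coeff_def S_def by blast
        then show ?thesis
          by (intro exI[of _ 0] exI[of _ "\<lambda>n. max 1 (of_nat (b n) * L (b n) / ennreal (\<epsilon> n))"] exI[of _ D])
            (use * of_nat_b in \<open>simp add: le_max_iff_disj\<close>)
      next
        assume *: "sch = Nonoverlapping"
          "(\<lambda>n. \<Sum>t<n. ennreal (real (t + 1) powr (real p - 2)) * mixed_coeff 1 M X t) \<prec> (\<lambda>n. ennreal (real (b n) powr (real p - 2)))"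
          "(\<lambda>n. ennreal (real (b n) / real n) * max (max 1 (of_nat (b n) * L (b n) / ennreal (\<epsilon> n)))
              (of_nat (b n) * (L (b n))\<^sup>2 / (ennreal (\<epsilon> n))\<^sup>2)) \<prec> (\<lambda>n. ennreal (real n powr (- \<delta>)))"
        obtain D where "0 \<le> D" "\<forall>n\<ge>1. S 1 n \<le> ennreal (D * (case sch of Overlapping \<Rightarrow> 1 | Nonoverlapping \<Rightarrow> real (b n) ^ (p - 2)))"
          using nonoverlapping[of 1] * unfolding coeff_def S_def by blast
        then show ?thesis
          by (intro exI[of _ 1] exI[of _ "\<lambda>n. max (max 1 (of_nat (b n) * L (b n) / ennreal (\<epsilon> n)))
              (of_nat (b n) * (L (b n))\<^sup>2 / (ennreal (\<epsilon> n))\<^sup>2)"] exI[of _ D])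
            (use * of_nat_b in \<open>simp add: le_max_iff_disj\<close>)
      qed
    qed
    then obtain \<kappa> R D where \<kappa>: "0 \<le> \<kappa>" and D: "0 \<le> D"
      and R: "\<And>n. n \<ge> 1 \<Longrightarrow> 1 \<le> R n" "\<And>n. n \<ge> 1 \<Longrightarrow> L (b n) / ennreal (\<epsilon> n) \<le> R n"
        "\<And>n. n \<ge> 1 \<Longrightarrow> ennreal \<kappa> * (of_nat (b n) * (L (b n))\<^sup>2 / (ennreal (\<epsilon> n))\<^sup>2) \<le> R n"
      and rate: "(\<lambda>n. ennreal (real (b n) / real n) * R n) \<prec> (\<lambda>n. ennreal (real n powr (- \<delta>)))"
      and S: "\<And>n. n \<ge> 1 \<Longrightarrow> S \<kappa> n \<le> ennreal (D * (case sch of Overlapping \<Rightarrow> 1 | Nonoverlapping \<Rightarrow> real (b n) ^ (p - 2)))"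
      by blast
    have S_fin: "S \<kappa> n < \<infinity>" for n
    proof (cases "n \<ge> 1")
      case True
      show ?thesis by (rule le_less_trans[OF S[OF True]]) simp
    next
      case False
      then have "n = 0" by simp
      then show ?thesis by (simp add: S_def)
    qed
    obtain e where e: "\<And>t. mixed_coeff \<kappa> M X t = ennreal (e t)" "\<And>t. 0 \<le> e t"
      and S_eq: "\<And>n. S \<kappa> n = ennreal (\<Sum>t<n. real (t + 1) ^ (p - 2) * e t)"
      using ex_real_coefficients[OF p2, of "coeff \<kappa>"] S_fin unfolding S_def coeff_def by blast
    have sum_e: "(\<Sum>t<n. real (t + 1) ^ (p - 2) * e t)
        \<le> D * (case sch of Overlapping \<Rightarrow> 1 | Nonoverlapping \<Rightarrow> real (b n) ^ (p - 2))" if "n \<ge> 1" for n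
      using S[OF that] D unfolding S_eq by (subst (asm) ennreal_le_iff) (auto split: scheme.split)
    have "\<exists>c l \<Lambda>. (\<forall>n. 0 \<le> l n) \<and> (\<forall>n\<ge>1. L (b n) = ennreal (l n) \<and> 1 \<le> \<Lambda> n \<and> l n / \<epsilon> n \<le> \<Lambda> n
      \<and> \<kappa> * real (b n) * (l n / \<epsilon> n)\<^sup>2 \<le> \<Lambda> n \<and> real (b n) / real n * \<Lambda> n \<le> c * real n powr (- \<delta>))"
      by (rule ex_real_rate[where L = L and b = b and \<epsilon> = \<epsilon> and R = R, OF b(1) \<epsilon>(1) \<kappa> R rate]) assumption+
    then obtain c l \<Lambda> where l0: "\<And>n. 0 \<le> l n"
      and rates: "\<forall>n\<ge>1. L (b n) = ennreal (l n) \<and> 1 \<le> \<Lambda> n \<and> l n / \<epsilon> n \<le> \<Lambda> n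
        \<and> \<kappa> * real (b n) * (l n / \<epsilon> n)\<^sup>2 \<le> \<Lambda> n \<and> real (b n) / real n * \<Lambda> n \<le> c * real n powr (- \<delta>)"
      by blast
    have l: "L (b n) = ennreal (l n)" and \<Lambda>: "1 \<le> \<Lambda> n" "l n / \<epsilon> n \<le> \<Lambda> n"
        "\<kappa> * real (b n) * (l n / \<epsilon> n)\<^sup>2 \<le> \<Lambda> n"
      and rate': "real (b n) / real n * \<Lambda> n \<le> c * real n powr (- \<delta>)" if "n \<ge> 1" for n
      using rates that by blast+
    have lip: "lipschitz_tuples (b n) (l n) (s (b n))" if "n \<ge> 1" for n
      using l[OF that] l0 unfolding L_def by (rule Lip_eq_imp_lipschitz_tuples)
    have b1: "b n \<ge> 1" if "n \<ge> 1" for n using b(1)[OF that] by simp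
    obtain A where A0: "0 \<le> A" and A: "\<And>n x. n \<ge> 1 \<Longrightarrow> abs_central_moment M p (Kt n x)
        \<le> A * real n powr (- (real ((p + 1) div 2) * \<delta>))"
      using smooth_subsampling_moment_bound[where sch = sch, OF X s b1 b(3) \<epsilon>(1) p2 e \<kappa> lip \<Lambda> rate' \<delta> D sum_e]
      unfolding Kt_def by blast
    have moments: "(\<lambda>n. ennreal (abs_central_moment M p (Kt n x)))
        \<prec> (\<lambda>n. ennreal (real n powr (- (real (p div 2) * \<delta>))))" for x
      unfolding asymp_le_def
    proof (intro exI[of _ "A + 1"] conjI allI impI)
      fix n :: nat assume n: "n \<ge> 1"
      have "abs_central_moment M p (Kt n x) \<le> A * real n powr (- (real ((p + 1) div 2) * \<delta>))" by (rule A[OF n])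
      also have "\<dots> \<le> (A + 1) * real n powr (- (real (p div 2) * \<delta>))"
        using n \<delta> A0 by (intro mult_mono powr_mono) (auto intro!: mult_right_mono of_nat_mono div_le_mono)
      finally show "ennreal (abs_central_moment M p (Kt n x)) \<le> ennreal (A + 1) * ennreal (real n powr (- (real (p div 2) * \<delta>)))"
        using A0 by (simp add: ennreal_leI ennreal_mult'[symmetric] del: ennreal_plus)
    qed (use A0 in simp)
    moreover have "AE \<omega> in M. (\<lambda>n. SUP x. \<bar>Kt n x \<omega> - K x\<bar>) \<longlonglongrightarrow> 0" if ev: "even p" and big: "real p * \<delta> > 2"
      unfolding Kt_def K'(3)
    proof (rule AE_uniform_convergence_smooth_subsampling[OF X st s b \<epsilon>])
      show "real_distribution (density lborel (\<lambda>x. ennreal (K' x)))"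
        by (rule prob_density_imp_real_distribution) (rule K'(2))
      show "isCont (cdf (density lborel (\<lambda>x. ennreal (K' x)))) x" for x
        using K'(1,2) by (intro isCont_cdf_density) simp_all
      show "(\<lambda>n. SUP x. \<bar>stat_cdf M X s n x - cdf (density lborel (\<lambda>x. ennreal (K' x))) x\<bar>) \<longlonglongrightarrow> 0"
        using r unfolding K'(3) .
      show "even p" "0 < p" using ev p by auto
      show "1 < real (p div 2) * \<delta>" using ev big by (auto elim!: evenE)
      show "abs_central_moment M p (smooth_subsampling sch X s (b n) (\<epsilon> n) n x)
          \<le> A * real n powr (- (real (p div 2) * \<delta>))" if "n \<ge> 1" for n x
        using A[OF that, of x] ev unfolding Kt_def by (auto elim!: evenE)
    qed
    ultimately show ?thesis by blast
  qed
qed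

end
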